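(* Let $\Omega$ be a locally compact and separable metric space with Borel $\sigma$-algebra $\mathcal{B}(\Omega)$. Let $T=(T_\omega)$ be a random $\mathbb{Z}_+$-dynamical system on a compact metric space $X$ over an ergodic measure-preserving system $(\Omega,\mathcal{B}(\Omega),\mathbb{P},\theta)$. If $h^*_{pre}(T)<\infty$, then $$h^*_{pre}(T)=\max_{\mu\in\mathcal{M}_{\mathbb{P}}(\Omega\times X,G)}h^*_{pre,\mu}(T),\qquad h^*_{pre,s}(T)=\max_{\mu\in\mathcal{M}_{\mathbb{P}}(\Omega\times X,G)}h^*_{s,\mu}(T)\quad\text{for } s\in\{p,m\},$$ where $G=\mathbb{Z}_+$.
   Context: A random $\mathbb{Z}_+$-dynamical system over a measure-preserving system $(\Omega,\mathcal{F},\mathbb{P},\theta)$ is given by continuous maps $T_\omega:X\to X$ ($\omega\in\Omega$) of a compact metric space $(X,d)$, with $(\omega,x)\mapsto T_\omega x$ measurable; iterates are $T_\omega^n=T_{\theta^{n-1}\omega}\circ\cdots\circ T_\omega$ for $n\ge1$, $T_\omega^0=\mathrm{id}$. The skew product is $\Theta(\omega,x)=(\theta\omega,T_\omega x)$. For $x\in X$, $T_\omega^{-k}x=(T_\omega^k)^{-1}\{x\}$. $L^1_{\mathbb{P}}(\Omega,C(X))$ is the Banach space of functions $f:\Omega\times X\to\mathbb{R}$, measurable in $(\omega,x)$ and continuous in $x$, with $\|f\|=\int\sup_{x}|f(\omega,x)|\,d\mathbb{P}(\omega)<\infty$ (identifying $f,g$ with $\|f-g\|=0$). $\mathcal{P}_{\mathbb{P}}(\Omega\times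 X)$ is the set of probability measures on $\Omega\times X$ (with $\mathcal{F}\otimes\mathcal{B}(X)$) whose marginal on $\Omega$ is $\mathbb{P}$, and $\mathcal{M}_{\mathbb{P}}(\Omega\times X,G)$ is the subset of $\Theta$-invariant ones. Let $d_n^\omega(x,y)=\max_{0\le j\le n-1}d(T_\omega^jx,T_\omega^jy)$ and $S_nf(\omega,x)=\sum_{j=0}^{n-1}f(\theta^j\omega,T_\omega^jx)$. A set $F\subset E\subset X$ is an $(\omega,n,\epsilon)$-separated set of $E$ if $d_n^\omega(x,y)>\epsilon$ for all distinct $x,y\in F$. For $f\in L^1_{\mathbb{P}}(\Omega,C(X))$ define $$P_{pre,n}(T,f,\omega,\epsilon,k)=\sup_{x\in X}\sup\Big\{\sum_{y\in F}e^{S_nf(\omega,y)}:F\text{ is an }(\omega,n,\epsilon)\text{-separated set of }T_\omega^{-k}x\Big\},$$ $$P_{pre}(T,f,\epsilon)=\limsup_{n\to\infty}\frac1n\sup_{k\ge n}\int\log P_{pre,n}(T,f,\omega,\epsilon,k)\,d\mathbb{P}(\omega),\qquad P^*_{pre}(T,f)=\lim_{\epsilon\to0}P_{pre}(T,f,\epsilon),$$ $$P_{pre,n}(T,f,\omega,x,\epsilon)=\sup\Big\{\sum_{y\in E}e^{S_nf(\omega,y)}:E\text{ is an }(\omega,n,\epsilon)\text{-separated set of }T_\omega^{-n}x\Big\},$$ $$P_{pre,m}(T,f,\epsilon)=\limsup_{n\to\infty}\frac1n\int\log\sup_{x\in X}P_{pre,n}(T,f,\omega,x,\epsilon)\,d\mathbb{P}(\omega),$$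 $$P_{pre,p}(T,f,\epsilon)=\sup_{x\in X}\limsup_{n\to\infty}\frac1n\int\log P_{pre,n}(T,f,\omega,x,\epsilon)\,d\mathbb{P}(\omega),$$ $P^*_{pre,s}(T,f)=\lim_{\epsilon\to0}P_{pre,s}(T,f,\epsilon)$ for $s\in\{m,p\}$ (these integrands are measurable in $\omega$; empty sums are $0$ and $\log0=-\infty$). Put $h^*_{pre}(T)=P^*_{pre}(T,0)$ and $h^*_{pre,s}(T)=P^*_{pre,s}(T,0)$. For $\mu\in\mathcal{P}_{\mathbb{P}}(\Omega\times X)$, $$h^*_{pre,\mu}(T)=\inf\Big\{P^*_{pre}(T,f)-\int f\,d\mu:f\in L^1_{\mathbb{P}}(\Omega,C(X))\Big\},\quad h^*_{s,\mu}(T)=\inf\Big\{P^*_{pre,s}(T,f)-\int f\,d\mu:f\in L^1_{\mathbb{P}}(\Omega,C(X))\Big\}.$$ *)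

theory Defs
  imports "HOL-Probability.Probability"
begin

definition measure_preserving_system :: "'w measure \<Rightarrow> ('w \<Rightarrow> 'w) \<Rightarrow> bool" where
  "measure_preserving_system P \<theta> \<longleftrightarrow>
     prob_space P \<and> \<theta> \<in> measurable P P \<and> distr P P \<theta> = P"

definition ergodic_system :: "'w measure \<Rightarrow> ('w \<Rightarrow> 'w) \<Rightarrow> bool" where
  "ergodic_system P \<theta> \<longleftrightarrow>
     measure_preserving_system P \<theta> \<and>
     (\<forall>A\<in>sets P. \<theta> -` A \<inter> space P = A \<longrightarrow> measure P A = 0 \<or> measure P A = 1)"

text \<open>The phase space is the whole type \<^typ>\<open>'x\<close>; its compactness is a separate hypothesis
  wherever it is needed.\<close>

definition random_maps :: "'w measure \<Rightarrow> ('w \<Rightarrow> 'x::metric_space \<Rightarrow> 'x) \<Rightarrow> bool" where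
  "random_maps P T \<longleftrightarrow>
     (\<forall>\<omega>\<in>space P. continuous_on UNIV (T \<omega>)) \<and>
     (\<lambda>(\<omega>, x). T \<omega> x) \<in> measurable (P \<Otimes>\<^sub>M borel) borel"

fun iter :: "('w \<Rightarrow> 'w) \<Rightarrow> ('w \<Rightarrow> 'x \<Rightarrow> 'x) \<Rightarrow> nat \<Rightarrow> 'w \<Rightarrow> 'x \<Rightarrow> 'x" where
  "iter \<theta> T 0 \<omega> = id"
| "iter \<theta> T (Suc n) \<omega> = T ((\<theta> ^^ n) \<omega>) \<circ> iter \<theta> T n \<omega>"

definition skew_product :: "('w \<Rightarrow> 'w) \<Rightarrow> ('w \<Rightarrow> 'x \<Rightarrow> 'x) \<Rightarrow> 'w \<times> 'x \<Rightarrow> 'w \<times> 'x" where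
  "skew_product \<theta> T = (\<lambda>(\<omega>, x). (\<theta> \<omega>, T \<omega> x))"

text \<open>The members are functions, not classes modulo functions of norm zero. This does not affect
  the infima below: changing \<open>f\<close> within its class changes neither its pressures nor its integral
  against a measure with marginal \<open>P\<close>.\<close>

definition L1_C :: "'w measure \<Rightarrow> ('w \<times> 'x::metric_space \<Rightarrow> real) set" where
  "L1_C P = {f \<in> borel_measurable (P \<Otimes>\<^sub>M borel).
     (\<forall>\<omega>\<in>space P. continuous_on UNIV (\<lambda>x. f (\<omega>, x))) \<and>
     (\<integral>\<^sup>+ \<omega>. (SUP x. ennreal \<bar>f (\<omega>, x)\<bar>) \<partial>P) < \<infinity>}"

definition marginal_measures :: "'w measure \<Rightarrow> ('w \<times> 'x::metric_space) measure set" where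
  "marginal_measures P =
     {\<mu>. prob_space \<mu> \<and> sets \<mu> = sets (P \<Otimes>\<^sub>M borel) \<and> distr \<mu> P fst = P}"

definition invariant_measures ::
  "'w measure \<Rightarrow> ('w \<Rightarrow> 'w) \<Rightarrow> ('w \<Rightarrow> 'x::metric_space \<Rightarrow> 'x) \<Rightarrow> ('w \<times> 'x) measure set" where
  "invariant_measures P \<theta> T =
     {\<mu> \<in> marginal_measures P. distr \<mu> \<mu> (skew_product \<theta> T) = \<mu>}"

text \<open>The Bowen metric and the separated sets are only meaningful for \<open>n \<ge> 1\<close>; the value at
  \<open>n = 0\<close> does not influence the upper limits below.\<close>

definition bowen_dist ::
  "('w \<Rightarrow> 'w) \<Rightarrow> ('w \<Rightarrow> 'x::metric_space \<Rightarrow> 'x) \<Rightarrow> nat \<Rightarrow> 'w \<Rightarrow> 'x \<Rightarrow> 'x \<Rightarrow> real" where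
  "bowen_dist \<theta> T n \<omega> x y = Max ((\<lambda>j. dist (iter \<theta> T j \<omega> x) (iter \<theta> T j \<omega> y)) ` {0..<n})"

definition birkhoff_sum ::
  "('w \<Rightarrow> 'w) \<Rightarrow> ('w \<Rightarrow> 'x \<Rightarrow> 'x) \<Rightarrow> ('w \<times> 'x \<Rightarrow> real) \<Rightarrow> nat \<Rightarrow> 'w \<Rightarrow> 'x \<Rightarrow> real" where
  "birkhoff_sum \<theta> T f n \<omega> x = (\<Sum>j = 0..<n. f ((\<theta> ^^ j) \<omega>, iter \<theta> T j \<omega> x))"

definition separated_set ::
  "('w \<Rightarrow> 'w) \<Rightarrow> ('w \<Rightarrow> 'x::metric_space \<Rightarrow> 'x) \<Rightarrow> 'w \<Rightarrow> nat \<Rightarrow> real \<Rightarrow> 'x set \<Rightarrow> 'x set \<Rightarrow> bool" where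
  "separated_set \<theta> T \<omega> n \<epsilon> E F \<longleftrightarrow>
     F \<subseteq> E \<and> (\<forall>x\<in>F. \<forall>y\<in>F. x \<noteq> y \<longrightarrow> bowen_dist \<theta> T n \<omega> x y > \<epsilon>)"

text \<open>For \<open>n \<ge> 1\<close> and \<open>\<epsilon> > 0\<close>, separated sets in a compact space under continuous maps are
  finite, so the finite sum is the intended one. The empty set is always separated, so the
  supremum is \<open>0\<close> when \<open>x\<close> has no preimage.\<close>

definition pre_partition ::
  "('w \<Rightarrow> 'w) \<Rightarrow> ('w \<Rightarrow> 'x::metric_space \<Rightarrow> 'x) \<Rightarrow> ('w \<times> 'x \<Rightarrow> real) \<Rightarrow>
     nat \<Rightarrow> 'w \<Rightarrow> 'x \<Rightarrow> real \<Rightarrow> nat \<Rightarrow> ennreal" where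
  "pre_partition \<theta> T f n \<omega> x \<epsilon> k =
     (SUP F \<in> {F. separated_set \<theta> T \<omega> n \<epsilon> (iter \<theta> T k \<omega> -` {x}) F}.
        ennreal (\<Sum>y\<in>F. exp (birkhoff_sum \<theta> T f n \<omega> y)))"

definition log_ennreal :: "ennreal \<Rightarrow> ereal" where
  "log_ennreal a =
     (if a = 0 then -\<infinity> else if a = \<infinity> then \<infinity> else ereal (ln (enn2real a)))"

text \<open>Integral of an extended real function, positive part minus negative part. For the integrands
  used here, finiteness of the preimage entropy rules out the case \<open>\<infinity> - \<infinity>\<close> for all large \<open>n\<close>.\<close>

definition ereal_integral :: "'w measure \<Rightarrow> ('w \<Rightarrow> ereal) \<Rightarrow> ereal" where
  "ereal_integral P g =
     enn2ereal (\<integral>\<^sup>+ \<omega>. e2ennreal (g \<omega>) \<partial>P) - enn2ereal (\<integral>\<^sup>+ \<omega>. e2ennreal (- g \<omega>) \<partial>P)"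

definition P_pre_eps ::
  "'w measure \<Rightarrow> ('w \<Rightarrow> 'w) \<Rightarrow> ('w \<Rightarrow> 'x::metric_space \<Rightarrow> 'x) \<Rightarrow> ('w \<times> 'x \<Rightarrow> real) \<Rightarrow> real \<Rightarrow> ereal" where
  "P_pre_eps P \<theta> T f \<epsilon> =
     limsup (\<lambda>n. ereal (1 / real n) *
       (SUP k\<in>{n..}. ereal_integral P (\<lambda>\<omega>. log_ennreal (SUP x. pre_partition \<theta> T f n \<omega> x \<epsilon> k))))"

definition P_pre_m_eps ::
  "'w measure \<Rightarrow> ('w \<Rightarrow> 'w) \<Rightarrow> ('w \<Rightarrow> 'x::metric_space \<Rightarrow> 'x) \<Rightarrow> ('w \<times> 'x \<Rightarrow> real) \<Rightarrow> real \<Rightarrow> ereal" where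
  "P_pre_m_eps P \<theta> T f \<epsilon> =
     limsup (\<lambda>n. ereal (1 / real n) *
       ereal_integral P (\<lambda>\<omega>. log_ennreal (SUP x. pre_partition \<theta> T f n \<omega> x \<epsilon> n)))"

definition P_pre_p_eps ::
  "'w measure \<Rightarrow> ('w \<Rightarrow> 'w) \<Rightarrow> ('w \<Rightarrow> 'x::metric_space \<Rightarrow> 'x) \<Rightarrow> ('w \<times> 'x \<Rightarrow> real) \<Rightarrow> real \<Rightarrow> ereal" where
  "P_pre_p_eps P \<theta> T f \<epsilon> =
     (SUP x. limsup (\<lambda>n. ereal (1 / real n) *
       ereal_integral P (\<lambda>\<omega>. log_ennreal (pre_partition \<theta> T f n \<omega> x \<epsilon> n))))"

text \<open>The limits exist in the extended reals: shrinking \<open>\<epsilon>\<close> enlarges the family of separated sets,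
  so the quantities above are antitone in \<open>\<epsilon>\<close>.\<close>

definition P_pre ::
  "'w measure \<Rightarrow> ('w \<Rightarrow> 'w) \<Rightarrow> ('w \<Rightarrow> 'x::metric_space \<Rightarrow> 'x) \<Rightarrow> ('w \<times> 'x \<Rightarrow> real) \<Rightarrow> ereal" where
  "P_pre P \<theta> T f = Lim (at_right 0) (P_pre_eps P \<theta> T f)"

definition P_pre_m ::
  "'w measure \<Rightarrow> ('w \<Rightarrow> 'w) \<Rightarrow> ('w \<Rightarrow> 'x::metric_space \<Rightarrow> 'x) \<Rightarrow> ('w \<times> 'x \<Rightarrow> real) \<Rightarrow> ereal" where
  "P_pre_m P \<theta> T f = Lim (at_right 0) (P_pre_m_eps P \<theta> T f)"

definition P_pre_p ::
  "'w measure \<Rightarrow> ('w \<Rightarrow> 'w) \<Rightarrow> ('w \<Rightarrow> 'x::metric_space \<Rightarrow> 'x) \<Rightarrow> ('w \<times> 'x \<Rightarrow> real) \<Rightarrow> ereal" where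
  "P_pre_p P \<theta> T f = Lim (at_right 0) (P_pre_p_eps P \<theta> T f)"

definition h_pre :: "'w measure \<Rightarrow> ('w \<Rightarrow> 'w) \<Rightarrow> ('w \<Rightarrow> 'x::metric_space \<Rightarrow> 'x) \<Rightarrow> ereal" where
  "h_pre P \<theta> T = P_pre P \<theta> T (\<lambda>_. 0)"

definition h_pre_m :: "'w measure \<Rightarrow> ('w \<Rightarrow> 'w) \<Rightarrow> ('w \<Rightarrow> 'x::metric_space \<Rightarrow> 'x) \<Rightarrow> ereal" where
  "h_pre_m P \<theta> T = P_pre_m P \<theta> T (\<lambda>_. 0)"

definition h_pre_p :: "'w measure \<Rightarrow> ('w \<Rightarrow> 'w) \<Rightarrow> ('w \<Rightarrow> 'x::metric_space \<Rightarrow> 'x) \<Rightarrow> ereal" where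
  "h_pre_p P \<theta> T = P_pre_p P \<theta> T (\<lambda>_. 0)"

definition h_pre_measure ::
  "'w measure \<Rightarrow> ('w \<Rightarrow> 'w) \<Rightarrow> ('w \<Rightarrow> 'x::metric_space \<Rightarrow> 'x) \<Rightarrow> ('w \<times> 'x) measure \<Rightarrow> ereal" where
  "h_pre_measure P \<theta> T \<mu> = (INF f\<in>L1_C P. P_pre P \<theta> T f - ereal (\<integral>z. f z \<partial>\<mu>))"

definition h_m_measure ::
  "'w measure \<Rightarrow> ('w \<Rightarrow> 'w) \<Rightarrow> ('w \<Rightarrow> 'x::metric_space \<Rightarrow> 'x) \<Rightarrow> ('w \<times> 'x) measure \<Rightarrow> ereal" where
  "h_m_measure P \<theta> T \<mu> = (INF f\<in>L1_C P. P_pre_m P \<theta> T f - ereal (\<integral>z. f z \<partial>\<mu>))"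

definition h_p_measure ::
  "'w measure \<Rightarrow> ('w \<Rightarrow> 'w) \<Rightarrow> ('w \<Rightarrow> 'x::metric_space \<Rightarrow> 'x) \<Rightarrow> ('w \<times> 'x) measure \<Rightarrow> ereal" where
  "h_p_measure P \<theta> T \<mu> = (INF f\<in>L1_C P. P_pre_p P \<theta> T f - ereal (\<integral>z. f z \<partial>\<mu>))"

definition is_max_over :: "ereal \<Rightarrow> ('a \<Rightarrow> ereal) \<Rightarrow> 'a set \<Rightarrow> bool" where
  "is_max_over m h A \<longleftrightarrow> (\<exists>a\<in>A. h a = m) \<and> (\<forall>a\<in>A. h a \<le> m)"

end

theory Submission
  imports Defs
begin

text \<open>
  Each of the three pressures is a supremum of upper limits of integrals of log-sum-exp
  expressions, hence convex in \<open>f\<close>. By the Hahn-Banach theorem there is a linear functional \<open>L\<close> on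
  the space \<open>L1_C P\<close> below \<open>f \<mapsto> P_pre f - P_pre 0\<close>. Comparing Birkhoff sums shows that \<open>L\<close> is
  positive, that \<open>L c = \<integral>c dP\<close> if \<open>c\<close> depends on \<open>\<omega>\<close> only, and that \<open>L\<close> vanishes on coboundaries
  \<open>g \<circ> \<Theta> - g\<close>. Together with Dini's theorem on the compact fibres this makes \<open>L\<close> a Daniell
  integral, so \<open>L\<close> is integration against a \<open>\<Theta>\<close>-invariant measure with marginal \<open>P\<close>, which attains
  the maximum. If the pointwise pressure at \<open>0\<close> is \<open>-\<infinity>\<close>, any invariant measure attains it.
\<close>

section \<open>Linear functionals below convex functionals\<close>

text \<open>Taking \<open>f = 0\<close> in the infimum bounds each measure quantity by the
  corresponding entropy, so everything rests on one invariant measure for which \<open>f = 0\<close>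
  is a minimiser. Integration against it is a subgradient of the pressure at 0. Two obstacles shape
  the proof. Members of \<open>L1_C P\<close> are only measurable in \<omega>, so the functional is
  not represented by a Riesz theorem for continuous functions; monotone continuity takes that role.
  And the logarithms may be infinite, so inequalities are carried through their integrals as
  relations between nonnegative functions. This needs measurable partition functions, although these
  are suprema over uncountable families. The uniform pressures at 0 are nonnegative because the base
  point may vary with \<omega>. A fixed base point may have an empty fibre, whence the value
  -\<infinity>; the invariant measure for that case is the one constructed for
  \<open>P_pre_m\<close>.\<close>

locale function_space =
  fixes V :: "('a \<Rightarrow> real) set"
  assumes V_add: "f \<in> V \<Longrightarrow> g \<in> V \<Longrightarrow> (\<lambda>x. f x + g x) \<in> V"
    and V_scale: "f \<in> V \<Longrightarrow> (\<lambda>x. c * f x) \<in> V"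
    and V_const: "(\<lambda>_. c) \<in> V"
begin

lemma V_uminus: "f \<in> V \<Longrightarrow> (\<lambda>x. - f x) \<in> V"
  using V_scale[of f "-1"] by simp

lemma V_diff: "f \<in> V \<Longrightarrow> g \<in> V \<Longrightarrow> (\<lambda>x. f x - g x) \<in> V"
  using V_add[OF _ V_uminus, of f g] by simp

text \<open>Scaling is an inequality for positive factors, the form that infima of such functionals
  satisfy directly; applying it to \<open>c\<close> and to \<open>inverse c\<close> recovers
  equality.\<close>

definition sublinear :: "(('a \<Rightarrow> real) \<Rightarrow> real) \<Rightarrow> bool" where
  "sublinear p \<longleftrightarrow> (\<forall>f\<in>V. \<forall>g\<in>V. p (\<lambda>x. f x + g x) \<le> p f + p g) \<and>
     (\<forall>f\<in>V. \<forall>c>0. p (\<lambda>x. c * f x) \<le> c * p f)"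

definition linear_functional :: "(('a \<Rightarrow> real) \<Rightarrow> real) \<Rightarrow> bool" where
  "linear_functional p \<longleftrightarrow> (\<forall>f\<in>V. \<forall>g\<in>V. p (\<lambda>x. f x + g x) = p f + p g) \<and>
     (\<forall>f\<in>V. \<forall>c. p (\<lambda>x. c * f x) = c * p f)"

lemma sublinear_add: "sublinear p \<Longrightarrow> f \<in> V \<Longrightarrow> g \<in> V \<Longrightarrow> p (\<lambda>x. f x + g x) \<le> p f + p g"
  by (simp add: sublinear_def)

lemma sublinear_scale_le: "sublinear p \<Longrightarrow> f \<in> V \<Longrightarrow> c > 0 \<Longrightarrow> p (\<lambda>x. c * f x) \<le> c * p f"
  by (simp add: sublinear_def)

lemma sublinear_scale:
  assumes "sublinear p" "f \<in> V" "c > 0"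
  shows "p (\<lambda>x. c * f x) = c * p f"
proof (rule antisym)
  show "p (\<lambda>x. c * f x) \<le> c * p f"
    using assms by (rule sublinear_scale_le)
  have "p f \<le> inverse c * p (\<lambda>x. c * f x)"
    using sublinear_scale_le[OF assms(1) V_scale[OF assms(2), of c], of "inverse c"] assms(3)
    by (simp add: mult.assoc[symmetric])
  then show "c * p f \<le> p (\<lambda>x. c * f x)"
    using assms(3) by (simp add: field_simps)
qed

lemma sublinear_zero: "sublinear p \<Longrightarrow> p (\<lambda>_. 0) = 0"
  using sublinear_scale[of p "\<lambda>_. 0" 2] V_const[of 0] by simp

text \<open>Applied to a sublinear \<open>q\<close> below \<open>p\<close>, it yields
  \<open>- p (\<lambda>x. - f x) \<le> q f\<close>, a lower bound independent of \<open>q\<close>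
  that keeps infima over chains real.\<close>

lemma sublinear_uminus_ge:
  assumes "sublinear p" "f \<in> V"
  shows "- p (\<lambda>x. - f x) \<le> p f"
  using sublinear_add[OF assms V_uminus[OF assms(2)]] sublinear_zero[OF assms(1)] by simp

text \<open>For fixed \<open>a\<close> the functional \<open>f \<mapsto> INF t\<ge>0. m (f + t a) - t m a\<close> is sublinear and below \<open>m\<close>;
  minimality makes it equal to \<open>m\<close>, and \<open>t = 1\<close> gives superadditivity.\<close>

lemma minimal_sublinear_linear:
  assumes m: "sublinear m"
    and min: "\<And>q. sublinear q \<Longrightarrow> (\<And>f. f \<in> V \<Longrightarrow> q f \<le> m f) \<Longrightarrow> (\<And>f. f \<in> V \<Longrightarrow> m f \<le> q f)"
  shows "linear_functional m"
proof -
  have super: "m f + m a \<le> m (\<lambda>x. f x + a x)" if fV: "f \<in> V" and aV: "a \<in> V" for f a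
  proof -
    define w where "w f t = m (\<lambda>x. f x + t * a x) - t * m a" for f t
    define q where "q f = (INF t\<in>{0..}. w f t)" for f
    have mt: "m (\<lambda>x. t * a x) = t * m a" if "t \<ge> 0" for t
      using sublinear_scale[OF m aV, of t] sublinear_zero[OF m] that by (cases "t = 0") auto
    have w_ge: "- m (\<lambda>x. - f x) \<le> w f t" if "f \<in> V" "t \<ge> 0" for f t
    proof -
      have "m (\<lambda>x. t * a x) \<le> m (\<lambda>x. - f x) + m (\<lambda>x. f x + t * a x)"
        using sublinear_add[OF m V_uminus[OF that(1)] V_add[OF that(1) V_scale[OF aV, of t]]]
        by simp
      then show ?thesis
        using mt[OF that(2)] by (simp add: w_def)
    qed
    have bdd: "bdd_below (w f ` {0..})" if "f \<in> V" for f
      using w_ge[OF that] by (intro bdd_belowI2[where m = "- m (\<lambda>x. - f x)"]) auto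
    have q_le: "q f \<le> w f t" if "f \<in> V" "t \<ge> 0" for f t
      unfolding q_def using that bdd by (intro cINF_lower) auto
    have "sublinear q"
      unfolding sublinear_def
    proof (intro conjI ballI allI impI)
      fix f g assume f: "f \<in> V" and g: "g \<in> V"
      have *: "q (\<lambda>x. f x + g x) \<le> w f s + w g t" if "s \<ge> 0" "t \<ge> 0" for s t
      proof -
        \<comment> \<open>The parameters are added along with the functions, since the multiples
          \<open>s a\<close> and \<open>t a\<close> combine to \<open>(s + t) a\<close>.\<close>
        have "q (\<lambda>x. f x + g x) \<le> w (\<lambda>x. f x + g x) (s + t)"
          using f g that V_add by (intro q_le) auto
        also have "\<dots> \<le> w f s + w g t"
          using sublinear_add[OF m V_add[OF f V_scale[OF aV, of s]] V_add[OF g V_scale[OF aV, of t]]]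
          by (simp add: w_def algebra_simps)
        finally show ?thesis .
      qed
      have "q (\<lambda>x. f x + g x) - w g t \<le> q f" if "t \<ge> 0" for t
        unfolding q_def[of f] using *[OF _ that] by (intro cINF_greatest) (auto simp: algebra_simps)
      then have "q (\<lambda>x. f x + g x) - q f \<le> q g"
        unfolding q_def[of g] by (intro cINF_greatest) (auto simp: algebra_simps)
      then show "q (\<lambda>x. f x + g x) \<le> q f + q g"
        by simp
    next
      fix f and c :: real assume f: "f \<in> V" and c: "c > 0"
      have "q (\<lambda>x. c * f x) / c \<le> w f t" if "t \<ge> 0" for t
      proof -
        have "q (\<lambda>x. c * f x) \<le> w (\<lambda>x. c * f x) (c * t)"
          using f c that V_scale by (intro q_le) auto
        also have "\<dots> = c * w f t"
          using sublinear_scale[OF m V_add[OF f V_scale[OF aV, of t]] c]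
          by (simp add: w_def algebra_simps)
        finally show ?thesis
          using c by (simp add: field_simps)
      qed
      then have "q (\<lambda>x. c * f x) / c \<le> q f"
        unfolding q_def[of f] by (intro cINF_greatest) auto
      then show "q (\<lambda>x. c * f x) \<le> c * q f"
        using c by (simp add: field_simps)
    qed
    moreover have "q f \<le> m f" if "f \<in> V" for f
      using q_le[OF that, of 0] by (simp add: w_def)
    ultimately have "m f \<le> q f"
      using min[of q f] fV by blast
    also have "\<dots> \<le> w f 1"
      using q_le[OF fV, of 1] by simp
    finally show ?thesis
      by (simp add: w_def)
  qed
  have add: "m (\<lambda>x. f x + g x) = m f + m g" if "f \<in> V" "g \<in> V" for f g
    using super[OF that] sublinear_add[OF m that] by simp
  have neg: "m (\<lambda>x. - f x) = - m f" if "f \<in> V" for f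
    using add[OF that V_uminus[OF that]] sublinear_zero[OF m] by simp
  have "m (\<lambda>x. c * f x) = c * m f" if f: "f \<in> V" for f c
  proof -
    consider "c > 0" | "c = 0" | "c < 0" by linarith
    then show ?thesis
    proof cases
      case 3
      then show ?thesis
        using neg[OF V_scale[OF f, of "- c"]] sublinear_scale[OF m f, of "- c"] by simp
    qed (use sublinear_scale[OF m f] sublinear_zero[OF m] in auto)
  qed
  then show ?thesis
    using add by (simp add: linear_functional_def)
qed

text \<open>Zorn's lemma for the reversed pointwise order, with the pointwise infimum as bound of a
  chain. The infimum is subadditive because any two members of a chain are comparable.\<close>

lemma ex_minimal_sublinear:
  assumes p: "sublinear p"
  shows "\<exists>m. sublinear m \<and> (\<forall>f\<in>V. m f \<le> p f) \<and>
    (\<forall>q. sublinear q \<longrightarrow> (\<forall>f\<in>V. q f \<le> m f) \<longrightarrow> (\<forall>f\<in>V. m f \<le> q f))"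
proof -
  \<comment> \<open>Functionals are total functions, but only their values on \<open>V\<close> are
    controlled; the fixed value 0 outside \<open>V\<close> makes the order antisymmetric.\<close>
  define A where "A = {q. sublinear q \<and> (\<forall>f\<in>V. q f \<le> p f) \<and> (\<forall>f. f \<notin> V \<longrightarrow> q f = 0)}"
  define R where "R q r \<longleftrightarrow> (\<forall>f\<in>V. r f \<le> q f)" for q r :: "('a \<Rightarrow> real) \<Rightarrow> real"
  have ext: "sublinear (\<lambda>f. if f \<in> V then q f else 0)" if "sublinear q" for q
    using that unfolding sublinear_def by (auto simp: V_add V_scale)
  have lower: "- p (\<lambda>x. - f x) \<le> q f" if "q \<in> A" "f \<in> V" for q f
    using sublinear_uminus_ge[of q f] V_uminus[OF that(2)] that by (force simp: A_def)
  have "\<exists>m\<in>A. \<forall>q\<in>A. R m q \<longrightarrow> q = m"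
  proof (rule predicate_Zorn)
    show "partial_order_on A (relation_of R A)"
    proof (rule partial_order_on_relation_ofI)
      fix q r assume "q \<in> A" "r \<in> A" "R q r" "R r q"
      then have "q f = r f" for f
        by (cases "f \<in> V") (auto simp: R_def A_def intro: antisym)
      then show "q = r" by blast
    qed (auto simp: R_def intro: order_trans)
  next
    fix C assume C: "C \<in> Chains (relation_of R A)"
    then have CA: "C \<subseteq> A"
      by (rule Chains_relation_of)
    have total: "R q r \<or> R r q" if "q \<in> C" "r \<in> C" for q r
      using C that by (auto simp: Chains_def relation_of_def)
    show "\<exists>u\<in>A. \<forall>q\<in>C. R q u"
    proof (cases "C = {}")
      case True
      moreover have "(\<lambda>f. if f \<in> V then p f else 0) \<in> A"
        using ext[OF p] by (simp add: A_def)
      ultimately show ?thesis by blast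
    next
      case False
      define u where "u f = (if f \<in> V then INF q\<in>C. q f else 0)" for f
      have u_le: "u f \<le> q f" if "q \<in> C" "f \<in> V" for q f
      proof -
        have "bdd_below ((\<lambda>q. q f) ` C)"
          using lower[OF _ that(2)] CA by (intro bdd_belowI2) auto
        then show ?thesis
          using that by (simp add: u_def cINF_lower[where f = "\<lambda>q. q f"])
      qed
      have u_ge: "c \<le> u f" if "f \<in> V" "\<And>q. q \<in> C \<Longrightarrow> c \<le> q f" for f c
        using that False by (auto simp: u_def intro!: cINF_greatest)
      have "sublinear u"
        unfolding sublinear_def
      proof (intro conjI ballI allI impI)
        fix f g assume f: "f \<in> V" and g: "g \<in> V"
        \<comment> \<open>The infima at \<open>f\<close> and at \<open>g\<close> may be approached
          by different members of the chain; the smaller of the two serves both arguments.\<close>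
        have "u (\<lambda>x. f x + g x) \<le> q f + r g" if q: "q \<in> C" and r: "r \<in> C" for q r
        proof (cases "R q r")
          case True
          have "u (\<lambda>x. f x + g x) \<le> r (\<lambda>x. f x + g x)"
            using r V_add[OF f g] by (rule u_le)
          also have "\<dots> \<le> r f + r g"
            using r CA f g by (intro sublinear_add) (auto simp: A_def)
          finally show ?thesis
            using True f by (force simp: R_def)
        next
          case False
          have "u (\<lambda>x. f x + g x) \<le> q (\<lambda>x. f x + g x)"
            using q V_add[OF f g] by (rule u_le)
          also have "\<dots> \<le> q f + q g"
            using q CA f g by (intro sublinear_add) (auto simp: A_def)
          finally show ?thesis
            using False total[OF q r] g by (force simp: R_def)
        qed
        then have "u (\<lambda>x. f x + g x) - r g \<le> u f" if "r \<in> C" for r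
          using that by (intro u_ge[OF f]) (simp add: algebra_simps)
        then have "u (\<lambda>x. f x + g x) - u f \<le> u g"
          by (intro u_ge[OF g]) (simp add: algebra_simps)
        then show "u (\<lambda>x. f x + g x) \<le> u f + u g"
          by simp
      next
        fix f and c :: real assume f: "f \<in> V" and c: "c > 0"
        have "u (\<lambda>x. c * f x) / c \<le> q f" if "q \<in> C" for q
        proof -
          have "u (\<lambda>x. c * f x) \<le> q (\<lambda>x. c * f x)"
            using that V_scale[OF f] by (rule u_le)
          also have "\<dots> \<le> c * q f"
            using that CA f c by (intro sublinear_scale_le) (auto simp: A_def)
          finally show ?thesis
            using c by (simp add: field_simps)
        qed
        then have "u (\<lambda>x. c * f x) / c \<le> u f"
          by (rule u_ge[OF f])
        then show "u (\<lambda>x. c * f x) \<le> c * u f"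
          using c by (simp add: field_simps)
      qed
      moreover have "u f \<le> p f" if "f \<in> V" for f
      proof -
        obtain q where "q \<in> C" using False by blast
        then show ?thesis
          using u_le[of q f] that CA by (force simp: A_def)
      qed
      ultimately have "u \<in> A"
        by (simp add: A_def u_def)
      then show ?thesis
        using u_le by (auto simp: R_def)
    qed
  qed
  then obtain m where m: "m \<in> A" and min: "\<And>q. q \<in> A \<Longrightarrow> R m q \<Longrightarrow> q = m"
    by blast
  have "m f \<le> q f" if q: "sublinear q" "\<forall>f\<in>V. q f \<le> m f" and f: "f \<in> V" for q f
  proof -
    have "(\<lambda>f. if f \<in> V then q f else 0) \<in> A"
      using ext[OF q(1)] q(2) m by (force simp: A_def)
    then have "(\<lambda>f. if f \<in> V then q f else 0) = m"
      using q(2) by (intro min) (auto simp: R_def)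
    from fun_cong[OF this, of f] show ?thesis
      using f by simp
  qed
  then show ?thesis
    using m by (auto simp: A_def)
qed

text \<open>The Hahn-Banach theorem without extension from subspaces: a minimal sublinear functional
  below \<open>p\<close> is already linear.\<close>

theorem sublinear_dominates_linear:
  assumes "sublinear p"
  shows "\<exists>L. linear_functional L \<and> (\<forall>f\<in>V. L f \<le> p f)"
  using ex_minimal_sublinear[OF assms] minimal_sublinear_linear by metis

text \<open>For convex \<open>q\<close> vanishing at 0 the quotients \<open>q (t f) / t\<close>
  increase with \<open>t\<close>, so \<open>p\<close> in the proof is the one-sided directional
  derivative of \<open>q\<close> at 0. It is sublinear and below \<open>q\<close>, and a linear
  functional below it is a subgradient.\<close>

theorem convex_dominates_linear:
  assumes zero: "q (\<lambda>_. 0) = 0"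
    and convex: "\<And>f g s t. f \<in> V \<Longrightarrow> g \<in> V \<Longrightarrow> s > 0 \<Longrightarrow> t > 0 \<Longrightarrow> s + t = 1 \<Longrightarrow>
      q (\<lambda>x. s * f x + t * g x) \<le> s * q f + t * q g"
  shows "\<exists>L. linear_functional L \<and> (\<forall>f\<in>V. L f \<le> q f)"
proof -
  define w where "w f t = q (\<lambda>x. t * f x) / t" for f and t :: real
  define p where "p f = (INF t\<in>{0<..}. w f t)" for f
  have w_ge: "- q (\<lambda>x. - f x) \<le> w f t" if "f \<in> V" "t > 0" for f t
  proof -
    \<comment> \<open>The weights make the combination of \<open>t f\<close> and \<open>- f\<close>
      vanish; this bounds the quotients from below.\<close>
    have "q (\<lambda>x. (1 / (1 + t)) * (t * f x) + (t / (1 + t)) * (- f x))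
        \<le> (1 / (1 + t)) * q (\<lambda>x. t * f x) + (t / (1 + t)) * q (\<lambda>x. - f x)"
      using that V_scale V_uminus by (intro convex) (auto simp: field_simps)
    then have "0 \<le> (1 / (1 + t)) * q (\<lambda>x. t * f x) + (t / (1 + t)) * q (\<lambda>x. - f x)"
      using zero by simp
    also have "\<dots> = (q (\<lambda>x. t * f x) + t * q (\<lambda>x. - f x)) / (1 + t)"
      by (simp add: add_divide_distrib)
    finally have "0 \<le> q (\<lambda>x. t * f x) + t * q (\<lambda>x. - f x)"
      using that(2) by (simp add: zero_le_divide_iff)
    then show ?thesis
      using that(2) by (simp add: w_def field_simps)
  qed
  have bdd: "bdd_below (w f ` {0<..})" if "f \<in> V" for f
    using w_ge[OF that] by (intro bdd_belowI2[where m = "- q (\<lambda>x. - f x)"]) auto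
  have p_le: "p f \<le> w f t" if "f \<in> V" "t > 0" for f t
    unfolding p_def using that bdd by (intro cINF_lower) auto
  have "sublinear p"
    unfolding sublinear_def
  proof (intro conjI ballI allI impI)
    fix f g assume f: "f \<in> V" and g: "g \<in> V"
    have *: "p (\<lambda>x. f x + g x) \<le> w f s + w g t" if st: "s > 0" "t > 0" for s t
    proof -
      \<comment> \<open>Half the harmonic mean of \<open>s\<close> and \<open>t\<close>: with it
        \<open>v (f + g)\<close> is the convex combination of \<open>s f\<close> and
        \<open>t g\<close> with weights \<open>t / (s + t)\<close> and
        \<open>s / (s + t)\<close>.\<close>
      define v where "v = s * t / (s + t)"
      have v: "v > 0" "v = (t / (s + t)) * s" "v = (s / (s + t)) * t"
        using st by (auto simp: v_def)
      have "q (\<lambda>x. v * (f x + g x)) = q (\<lambda>x. (t / (s + t)) * (s * f x) + (s / (s + t)) * (t * g x))"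
        by (rule arg_cong[where f = q]) (use v(2,3) in \<open>simp add: algebra_simps add_divide_distrib\<close>)
      also have "\<dots> \<le> (t / (s + t)) * q (\<lambda>x. s * f x) + (s / (s + t)) * q (\<lambda>x. t * g x)"
        using f g st V_scale by (intro convex) (auto simp: add_divide_distrib[symmetric])
      also have "\<dots> = v * (w f s + w g t)"
        using st by (simp add: v_def w_def distrib_left)
      finally have "w (\<lambda>x. f x + g x) v \<le> w f s + w g t"
        using v(1) by (simp add: w_def field_simps)
      then show ?thesis
        using p_le[OF V_add[OF f g] v(1)] by simp
    qed
    have "p (\<lambda>x. f x + g x) - w g t \<le> p f" if "t > 0" for t
      unfolding p_def[of f] using *[OF _ that] by (intro cINF_greatest) (auto simp: algebra_simps)
    then have "p (\<lambda>x. f x + g x) - p f \<le> p g"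
      unfolding p_def[of g] by (intro cINF_greatest) (auto simp: algebra_simps)
    then show "p (\<lambda>x. f x + g x) \<le> p f + p g"
      by simp
  next
    fix f and c :: real assume f: "f \<in> V" and c: "c > 0"
    have "p (\<lambda>x. c * f x) / c \<le> w f t" if "t > 0" for t
    proof -
      have "p (\<lambda>x. c * f x) \<le> w (\<lambda>x. c * f x) (t / c)"
        using f c that V_scale by (intro p_le) auto
      also have "\<dots> = c * w f t"
        using c that by (simp add: w_def mult.assoc[symmetric])
      finally show ?thesis
        using c by (simp add: field_simps)
    qed
    then have "p (\<lambda>x. c * f x) / c \<le> p f"
      unfolding p_def[of f] by (intro cINF_greatest) auto
    then show "p (\<lambda>x. c * f x) \<le> c * p f"
      using c by (simp add: field_simps)
  qed
  then obtain L where "linear_functional L" "\<forall>f\<in>V. L f \<le> p f"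
    using sublinear_dominates_linear by blast
  moreover have "p f \<le> q f" if "f \<in> V" for f
    using p_le[OF that, of 1] by (simp add: w_def)
  ultimately show ?thesis
    by (meson order_trans)
qed

end

section \<open>Daniell integrals\<close>

text \<open>Clamping keeps the end points of each piece in order, possibly with an empty piece. Only
  \<open>max\<close> and \<open>min\<close> occur, so the same formulas with functions as end points
  stay inside a vector lattice.\<close>

lemma interval_diff:
  fixes a b c d :: real
  assumes "a \<le> b" "c \<le> d"
  shows "{a..<b} - {c..<d} = {a..<max a (min b c)} \<union> {min b (max a d)..<b}"
    and "{a..<max a (min b c)} \<inter> {min b (max a d)..<b} = {}"
  using assms by (auto simp: max_def min_def split: if_splits)

text \<open>\<open>sets_V\<close> works in two directions: it makes the members of \<open>V\<close>
  measurable, and it lets their integrals determine a finite measure.\<close>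

locale vector_lattice = function_space V for V :: "('a \<Rightarrow> real) set" +
  fixes M :: "'a measure"
  assumes V_abs: "f \<in> V \<Longrightarrow> (\<lambda>x. \<bar>f x\<bar>) \<in> V"
    and sets_V: "sets M = sigma_sets UNIV {{x. 0 < f x} |f. f \<in> V}"
begin

lemma V_max:
  assumes "f \<in> V" "g \<in> V"
  shows "(\<lambda>x. max (f x) (g x)) \<in> V"
proof -
  have "(\<lambda>x. (1/2) * ((f x + g x) + \<bar>f x - g x\<bar>)) \<in> V"
    using assms by (intro V_scale V_add V_abs V_diff)
  also have "(\<lambda>x. (1/2) * ((f x + g x) + \<bar>f x - g x\<bar>)) = (\<lambda>x. max (f x) (g x))"
    by (auto simp: fun_eq_iff max_def)
  finally show ?thesis .
qed

lemma V_min: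
  assumes "f \<in> V" "g \<in> V"
  shows "(\<lambda>x. min (f x) (g x)) \<in> V"
proof -
  have "(\<lambda>x. - max (- f x) (- g x)) \<in> V"
    using assms by (intro V_uminus V_max)
  also have "(\<lambda>x. - max (- f x) (- g x)) = (\<lambda>x. min (f x) (g x))"
    by (auto simp: fun_eq_iff max_def min_def)
  finally show ?thesis .
qed

lemmas V_intros = V_add V_diff V_uminus V_scale V_const V_max V_min V_abs

lemma V_sum: "(\<And>i. i \<in> I \<Longrightarrow> F i \<in> V) \<Longrightarrow> (\<lambda>x. \<Sum>i\<in>I. F i x) \<in> V"
  by (induction I rule: infinite_finite_induct) (auto intro: V_intros)

lemma space_V: "space M = UNIV"
  using sets_eq_imp_space_eq[of M "sigma UNIV {{x. 0 < f x} |f. f \<in> V}"] sets_V by simp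

lemma V_measurable:
  assumes "f \<in> V"
  shows "f \<in> borel_measurable M"
proof (rule borel_measurableI_greater)
  fix c
  have "{x. 0 < f x - c} \<in> sets M"
    unfolding sets_V using assms by (intro sigma_sets.Basic) (auto intro!: exI[of _ "\<lambda>x. f x - c"] V_intros)
  then show "{x \<in> space M. c < f x} \<in> sets M"
    by (simp add: space_V)
qed

text \<open>For \<open>f\<close> in \<open>V\<close> these truncations are again in
  \<open>V\<close>, with values between 0 and 1; through them statements about functions reach the
  generating sets.\<close>

lemma truncation_tendsto_indicator:
  "(\<lambda>n. min 1 (real n * max (f x) 0)) \<longlonglongrightarrow> indicator {x. 0 < f x} x"
proof (cases "f x > 0")
  case True
  have "eventually (\<lambda>n. min 1 (real n * max (f x) 0) = 1) sequentially"
  proof -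
    obtain N where N: "1 / f x < real N" using reals_Archimedean2 by blast
    show ?thesis
      using eventually_ge_at_top[of N]
    proof eventually_elim
      case (elim n)
      have "1 < real n * f x"
        using N elim True by (smt (verit) divide_less_eq of_nat_le_iff mult_right_mono)
      then show ?case using True by simp
    qed
  qed
  then show ?thesis using True by (simp add: tendsto_eventually)
next
  case False
  then have "min 1 (real n * max (f x) 0) = 0" for n by (simp add: max_def)
  then show ?thesis using False by simp
qed

text \<open>Two positivity sets intersect in the positivity set of the minimum, so they form a
  \<pi>-system; dominated convergence along the truncations gives equal measures on it.\<close>

lemma measure_eq_if_integrals_eq:
  assumes "finite_measure \<mu>" "finite_measure \<nu>"
    and sets: "sets \<mu> = sets M" "sets \<nu> = sets M"
    and eq: "\<And>f. f \<in> V \<Longrightarrow> (\<integral>x. f x \<partial>\<mu>) = (\<integral>x. f x \<partial>\<nu>)"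
  shows "\<mu> = \<nu>"
proof (rule measure_eqI_generator_eq)
  interpret \<mu>: finite_measure \<mu> by fact
  interpret \<nu>: finite_measure \<nu> by fact
  show "sets \<mu> = sigma_sets UNIV {{x. 0 < f x} |f. f \<in> V}" "sets \<nu> = sigma_sets UNIV {{x. 0 < f x} |f. f \<in> V}"
    using sets sets_V by auto
  show "Int_stable {{x. 0 < f x} |f. f \<in> V}"
  proof (rule Int_stableI)
    fix A B assume "A \<in> {{x. 0 < f x} |f. f \<in> V}" "B \<in> {{x. 0 < f x} |f. f \<in> V}"
    then obtain f g where "f \<in> V" "g \<in> V" "A = {x. 0 < f x}" "B = {x. 0 < g x}" by auto
    then show "A \<inter> B \<in> {{x. 0 < f x} |f. f \<in> V}"
      using V_min[of f g] by (intro CollectI exI[of _ "\<lambda>x. min (f x) (g x)"]) auto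
  qed
  have lim: "(\<lambda>n. \<integral>x. min 1 (real n * max (f x) 0) \<partial>\<kappa>) \<longlonglongrightarrow> measure \<kappa> {x. 0 < f x}"
    if f: "f \<in> V" and "finite_measure \<kappa>" and s: "sets \<kappa> = sets M" for f \<kappa>
  proof -
    interpret \<kappa>: finite_measure \<kappa> by fact
    have [measurable]: "f \<in> borel_measurable \<kappa>"
      using V_measurable[OF f] measurable_cong_sets[OF s refl] by blast
    have sp: "space \<kappa> = UNIV" using sets_eq_imp_space_eq[OF s] space_V by simp
    have meas: "{x. 0 < f x} \<in> sets \<kappa>"
      using measurable_sets[of f \<kappa> borel "{0<..}"] sp by (simp add: vimage_def)
    have "(\<lambda>n. \<integral>x. min 1 (real n * max (f x) 0) \<partial>\<kappa>) \<longlonglongrightarrow> (\<integral>x. indicator {x. 0 < f x} x \<partial>\<kappa>)"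
    proof (rule integral_dominated_convergence[where w = "\<lambda>_. 1"])
      show "AE x in \<kappa>. (\<lambda>n. min 1 (real n * max (f x) 0)) \<longlonglongrightarrow> indicator {x. 0 < f x} x"
        by (intro AE_I2 truncation_tendsto_indicator)
    qed (use meas in \<open>auto simp: abs_le_iff\<close>)
    then show ?thesis using meas by simp
  qed
  show "emeasure \<mu> X = emeasure \<nu> X" if X: "X \<in> {{x. 0 < f x} |f. f \<in> V}" for X
  proof -
    obtain f where f: "f \<in> V" "X = {x. 0 < f x}" using X by auto
    have "(\<lambda>x. min 1 (real n * max (f x) 0)) \<in> V" for n
      using f by (intro V_intros)
    from eq[OF this] have "measure \<mu> X = measure \<nu> X"
      using lim[OF f(1) assms(1) sets(1)] lim[OF f(1) assms(2) sets(2)] f(2)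
      by (simp add: LIMSEQ_unique)
    then show ?thesis
      by (simp add: \<mu>.emeasure_eq_measure \<nu>.emeasure_eq_measure)
  qed
  show "range (\<lambda>_::nat. UNIV) \<subseteq> {{x. 0 < f x} |f. f \<in> V}"
    by (auto intro!: exI[of _ "\<lambda>_. 1"] V_const)
qed (auto simp: finite_measure.emeasure_eq_measure[OF assms(1)])

end

locale daniell = vector_lattice V M for V :: "('a \<Rightarrow> real) set" and M +
  fixes L :: "('a \<Rightarrow> real) \<Rightarrow> real"
  assumes L_linear: "linear_functional L"
    and L_nonneg: "f \<in> V \<Longrightarrow> (\<And>x. 0 \<le> f x) \<Longrightarrow> 0 \<le> L f"
    and L_continuous: "(\<And>n::nat. F n \<in> V) \<Longrightarrow> (\<And>x. decseq (\<lambda>n. F n x)) \<Longrightarrow>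
      (\<And>x. (\<lambda>n. F n x) \<longlonglongrightarrow> 0) \<Longrightarrow> (\<lambda>n. L (F n)) \<longlonglongrightarrow> 0"
begin

lemma L_add: "f \<in> V \<Longrightarrow> g \<in> V \<Longrightarrow> L (\<lambda>x. f x + g x) = L f + L g"
  and L_scale: "f \<in> V \<Longrightarrow> L (\<lambda>x. c * f x) = c * L f"
  using L_linear by (auto simp: linear_functional_def)

lemma L_diff: "f \<in> V \<Longrightarrow> g \<in> V \<Longrightarrow> L (\<lambda>x. f x - g x) = L f - L g"
  using L_add[of f "\<lambda>x. (-1) * g x"] L_scale[of g "-1"] V_scale[of g "-1"] by simp

lemma L_zero: "L (\<lambda>_. 0) = 0"
  using L_scale[OF V_const[of 0], of 0] by simp

lemma L_sum: "(\<And>i. i \<in> I \<Longrightarrow> F i \<in> V) \<Longrightarrow> L (\<lambda>x. \<Sum>i\<in>I. F i x) = (\<Sum>i\<in>I. L (F i))"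
  by (induction I rule: infinite_finite_induct) (auto simp: L_zero L_add V_sum)

lemma L_mono: "f \<in> V \<Longrightarrow> g \<in> V \<Longrightarrow> (\<And>x. f x \<le> g x) \<Longrightarrow> L f \<le> L g"
  using L_nonneg[OF V_diff, of g f] L_diff[of g f] by simp

text \<open>The length of the section of a strip \<open>{(x, t). f x \<le> t < g x}\<close> at \<open>x\<close> is \<open>g x - f x\<close>, so countable additivity
  of \<open>L (g - f)\<close> on the semiring of strips follows from that of Lebesgue measure on each section.
  The representing measure of \<open>A\<close> is the measure of \<open>A \<times> {0..<1}\<close>.\<close>

definition strip :: "('a \<Rightarrow> real) \<Rightarrow> ('a \<Rightarrow> real) \<Rightarrow> ('a \<times> real) set" where
  "strip f g = {(x, t). f x \<le> t \<and> t < g x}"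

text \<open>The inequality makes \<open>g x - f x\<close> the length of the section at
  \<open>x\<close>, so that the strip determines this difference.\<close>

definition bounds :: "('a \<Rightarrow> real) \<Rightarrow> ('a \<Rightarrow> real) \<Rightarrow> bool" where
  "bounds f g \<longleftrightarrow> f \<in> V \<and> g \<in> V \<and> (\<forall>x. f x \<le> g x)"

lemma strip_section: "Pair x -` strip f g = {f x..<g x}"
  by (auto simp: strip_def)

text \<open>Different pairs can describe one strip, since an empty section does not fix its end
  points. Their difference is fixed nevertheless, which makes the premeasure well defined.\<close>

lemma strip_length:
  assumes "bounds f g" "bounds f' g'" "strip f g = strip f' g'"
  shows "g x - f x = g' x - f' x"
proof -
  have "emeasure lborel {f x..<g x} = emeasure lborel {f' x..<g' x}"
    using assms(3) strip_section by metis
  then show ?thesis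
    using assms(1,2) by (simp add: bounds_def)
qed

lemma semiring_strips: "semiring_of_sets UNIV {strip f g |f g. bounds f g}"
proof
  show "{} \<in> {strip f g |f g. bounds f g}"
    by (auto simp: bounds_def strip_def intro!: exI[of _ "\<lambda>_. 0"] V_const)
next
  fix a b assume "a \<in> {strip f g |f g. bounds f g}" "b \<in> {strip f g |f g. bounds f g}"
  then obtain f g f' g' where ab: "bounds f g" "bounds f' g'" "a = strip f g" "b = strip f' g'"
    by auto
  have V: "f \<in> V" "g \<in> V" "f' \<in> V" "g' \<in> V" and le: "\<And>x. f x \<le> g x" "\<And>x. f' x \<le> g' x"
    using ab by (auto simp: bounds_def)
  \<comment> \<open>The outer \<open>max\<close> in \<open>?u\<close> matters where the two sections
    are disjoint: it lifts the upper bound to the lower one, leaving an empty section.\<close>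
  let ?l = "\<lambda>x. max (f x) (f' x)" and ?u = "\<lambda>x. max (max (f x) (f' x)) (min (g x) (g' x))"
  have "bounds ?l ?u" "a \<inter> b = strip ?l ?u"
    using V ab by (auto simp: bounds_def strip_def intro: V_intros)
  then show "a \<inter> b \<in> {strip f g |f g. bounds f g}"
    by blast
  let ?u1 = "\<lambda>x. max (f x) (min (g x) (f' x))" and ?l2 = "\<lambda>x. min (g x) (max (f x) (g' x))"
  have "bounds f ?u1" "bounds ?l2 g"
    using V by (auto simp: bounds_def intro: V_intros)
  moreover have "a - b = strip f ?u1 \<union> strip ?l2 g"
  proof (intro set_eqI)
    fix z :: "'a \<times> real"
    show "z \<in> a - b \<longleftrightarrow> z \<in> strip f ?u1 \<union> strip ?l2 g"
      using interval_diff(1)[OF le(1)[of "fst z"] le(2)[of "fst z"]]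
      by (cases z) (simp add: ab strip_def set_eq_iff)
  qed
  moreover have "strip f ?u1 \<inter> strip ?l2 g = {}"
  proof -
    have "(x, t) \<notin> strip f ?u1 \<inter> strip ?l2 g" for x t
    proof -
      have "t \<notin> {f x..<?u1 x} \<inter> {?l2 x..<g x}"
        unfolding interval_diff(2)[OF le(1)[of x] le(2)[of x]] by blast
      then show ?thesis
        by (auto simp: strip_def)
    qed
    then show ?thesis by (metis ex_in_conv surj_pair)
  qed
  ultimately show "\<exists>C\<subseteq>{strip f g |f g. bounds f g}. finite C \<and> disjoint C \<and> a - b = \<Union> C"
    by (intro exI[of _ "{strip f ?u1, strip ?l2 g}"]) (auto simp: disjoint_def Int_commute)
qed simp

lemma L_strip_sums:
  assumes fg: "\<And>n::nat. bounds (f n) (g n)" and uv: "bounds u v"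
    and disj: "disjoint_family (\<lambda>n. strip (f n) (g n))"
    and un: "(\<Union>n. strip (f n) (g n)) = strip u v"
  shows "(\<lambda>n. L (\<lambda>x. g n x - f n x)) sums L (\<lambda>x. v x - u x)"
proof -
  have V: "u \<in> V" "v \<in> V" "\<And>n. f n \<in> V" "\<And>n. g n \<in> V"
    and le: "\<And>x. u x \<le> v x" "\<And>n x. f n x \<le> g n x"
    using fg uv by (auto simp: bounds_def)
  have sums: "(\<lambda>n. g n x - f n x) sums (v x - u x)" for x
  proof -
    have "(\<lambda>n. emeasure lborel {f n x..<g n x}) sums emeasure lborel (\<Union>n. {f n x..<g n x})"
    proof (rule sums_emeasure)
      show "disjoint_family (\<lambda>n. {f n x..<g n x})"
        using disj unfolding disjoint_family_on_def strip_section[symmetric, where x = x] by fastforce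
    qed auto
    also have "(\<Union>n. {f n x..<g n x}) = {u x..<v x}"
      unfolding strip_section[symmetric] un[symmetric] by auto
    finally show ?thesis
      using le by simp
  qed
  \<comment> \<open>The remainders lie in \<open>V\<close>, decrease because sections have
    nonnegative length, and tend to 0 pointwise: the situation of
    \<open>L_continuous\<close>.\<close>
  define r where "r n x = (v x - u x) - (\<Sum>i<n. g i x - f i x)" for n x
  have rV: "r n \<in> V" for n
    unfolding r_def using V by (intro V_intros V_sum)
  have "(\<lambda>n. L (r n)) \<longlonglongrightarrow> 0"
  proof (rule L_continuous[OF rV])
    show "decseq (\<lambda>n. r n x)" for x
      using le by (intro decseq_SucI) (simp add: r_def)
    show "(\<lambda>n. r n x) \<longlonglongrightarrow> 0" for x
      using tendsto_diff[OF tendsto_const sums[of x, unfolded sums_def], of "v x - u x"]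
      by (simp add: r_def)
  qed
  moreover have "L (r n) = L (\<lambda>x. v x - u x) - (\<Sum>i<n. L (\<lambda>x. g i x - f i x))" for n
    unfolding r_def using V by (subst L_diff) (auto intro!: V_intros V_sum L_sum)
  ultimately have "(\<lambda>n. L (\<lambda>x. v x - u x) - (\<Sum>i<n. L (\<lambda>x. g i x - f i x))) \<longlonglongrightarrow> 0"
    by simp
  from tendsto_diff[OF tendsto_const this, of "L (\<lambda>x. v x - u x)"] show ?thesis
    by (simp add: sums_def)
qed

section \<open>Extension to a measure by Caratheodory's theorem\<close>

definition strip_measure :: "('a \<times> real) measure" where
  "strip_measure = extend_measure UNIV {(f, g). bounds f g} (\<lambda>(f, g). strip f g)
     (\<lambda>(f, g). ennreal (L (\<lambda>x. g x - f x)))"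

lemma emeasure_strip:
  assumes "bounds f g"
  shows "emeasure strip_measure (strip f g) = ennreal (L (\<lambda>x. g x - f x))"
proof (rule extend_measure_caratheodory_pair[OF strip_measure_def, of f g])
  show "bounds f g" by fact
  show "semiring_of_sets UNIV {strip a b |a b. bounds a b}"
    by (rule semiring_strips)
  show "ennreal (L (\<lambda>x. j x - i x)) = 0" if "bounds i j" "strip i j = {}" for i j
  proof -
    have "strip i j = strip (\<lambda>_. 0) (\<lambda>_. 0)"
      using that by (auto simp: strip_def)
    moreover have "bounds (\<lambda>_. 0) (\<lambda>_. 0)"
      by (simp add: bounds_def V_const)
    ultimately have "j x - i x = 0" for x
      using strip_length[OF that(1), of "\<lambda>_. 0" "\<lambda>_. 0"] by simp
    then show ?thesis
      by (simp add: L_zero)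
  qed
  show "ennreal (L (\<lambda>x. j x - i x)) = ennreal (L (\<lambda>x. l x - k x))"
    if "bounds i j" "bounds k l" "strip i j = strip k l" for i j k l
    using strip_length[OF that] by simp
  show "(\<Sum>n. ennreal (L (\<lambda>x. B n x - A n x))) = ennreal (L (\<lambda>x. k x - j x))"
    if "\<And>n. bounds (A n) (B n)" "bounds j k" "disjoint_family (\<lambda>n. strip (A n) (B n))"
      "(\<Union>i. strip (A i) (B i)) = strip j k" for A B j k
  proof (rule suminf_ennreal_eq[OF _ L_strip_sums[OF that]])
    show "0 \<le> L (\<lambda>x. B n x - A n x)" for n
      using that(1)[of n] by (auto simp: bounds_def intro!: L_nonneg V_diff)
  qed
qed auto

lemma strip_in_sets: "bounds f g \<Longrightarrow> strip f g \<in> sets strip_measure"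
  unfolding strip_measure_def by (subst sets_extend_measure) (auto intro!: sigma_sets.Basic)

lemma space_strip_measure: "space strip_measure = UNIV"
  unfolding strip_measure_def by (simp add: space_extend_measure)

definition representing_measure :: "'a measure" where
  "representing_measure = distr (restrict_space strip_measure (UNIV \<times> {0..<1})) M fst"

lemma sets_representing_measure [simp, measurable_cong]: "sets representing_measure = sets M"
  by (simp add: representing_measure_def)

lemma slab_strip: "UNIV \<times> {0..<1} = strip (\<lambda>_. 0) (\<lambda>_. 1)" "bounds (\<lambda>_. 0) (\<lambda>_. 1)"
  by (auto simp: strip_def bounds_def V_const)

text \<open>The cylinder of height 1 over a positivity set need not be a strip, but it is the
  countable union of the strips below the truncations of \<open>f\<close>.\<close>

lemma fst_measurable_strip: "fst \<in> measurable (restrict_space strip_measure (UNIV \<times> {0..<1})) M"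
proof (rule measurable_sigma_sets[OF sets_V])
  fix A assume "A \<in> {{x. 0 < f x} |f. f \<in> V}"
  then obtain f where f: "f \<in> V" "A = {x. 0 < f x}" by auto
  define h where "h n x = min 1 (real n * max (f x) 0)" for n x
  have hV: "h n \<in> V" for n
    unfolding h_def using f by (intro V_intros)
  have h: "bounds (\<lambda>_. 0) (h n)" for n
    using hV by (simp add: bounds_def V_const) (simp add: h_def)
  have "A \<times> {0..<1} = (\<Union>n. strip (\<lambda>_. 0) (h n))"
  proof (intro equalityI subsetI)
    fix z assume "z \<in> A \<times> {0..<1::real}"
    then obtain x t where z: "z = (x, t)" "0 < f x" "0 \<le> t" "t < 1"
      using f(2) by auto
    \<comment> \<open>The strict inequality \<open>t < 1\<close> of the half-open slab lets some
      truncation pass above \<open>t\<close>.\<close>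
    have "(\<lambda>n. h n x) \<longlonglongrightarrow> 1"
      using truncation_tendsto_indicator[of f x] z by (simp add: h_def)
    then have "eventually (\<lambda>n. t < h n x) sequentially"
      using z by (auto dest: order_tendstoD(1))
    then obtain n where "t < h n x"
      by (auto simp: eventually_sequentially)
    then show "z \<in> (\<Union>n. strip (\<lambda>_. 0) (h n))"
      using z by (auto simp: strip_def)
  next
    fix z assume "z \<in> (\<Union>n. strip (\<lambda>_. 0) (h n))"
    then obtain n x t where z: "z = (x, t)" "0 \<le> t" "t < h n x"
      by (auto simp: strip_def)
    then have "0 < f x"
      by (auto simp: h_def max_def split: if_splits)
    then show "z \<in> A \<times> {0..<1}"
      using z f(2) by (auto simp: h_def)
  qed
  then have "A \<times> {0..<1} \<in> sets strip_measure"
    using strip_in_sets[OF h] by auto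
  moreover have "fst -` A \<inter> space (restrict_space strip_measure (UNIV \<times> {0..<1})) = A \<times> {0..<1}"
    by (auto simp: space_restrict_space space_strip_measure)
  moreover have "UNIV \<times> {0..<1} \<inter> space strip_measure \<in> sets strip_measure"
    using strip_in_sets[OF slab_strip(2)] unfolding slab_strip(1)[symmetric]
    by (simp add: space_strip_measure)
  ultimately show "fst -` A \<inter> space (restrict_space strip_measure (UNIV \<times> {0..<1}))
      \<in> sets (restrict_space strip_measure (UNIV \<times> {0..<1}))"
    by (auto simp: sets_restrict_space_iff)
qed (auto simp: space_V)

lemma emeasure_representing_measure:
  assumes "A \<in> sets M"
  shows "A \<times> {0..<1} \<in> sets strip_measure"
    and "emeasure representing_measure A = emeasure strip_measure (A \<times> {0..<1})"
proof -
  let ?S = "UNIV \<times> {0..<1::real}"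
  have S: "?S \<inter> space strip_measure \<in> sets strip_measure"
    using strip_in_sets[OF slab_strip(2)] unfolding slab_strip(1)[symmetric]
    by (simp add: space_strip_measure)
  have eq: "fst -` A \<inter> space (restrict_space strip_measure ?S) = A \<times> {0..<1}"
    by (auto simp: space_restrict_space space_strip_measure)
  show "A \<times> {0..<1} \<in> sets strip_measure"
    using measurable_sets[OF fst_measurable_strip assms] eq S by (simp add: sets_restrict_space_iff)
  show "emeasure representing_measure A = emeasure strip_measure (A \<times> {0..<1})"
    unfolding representing_measure_def emeasure_distr[OF fst_measurable_strip assms] eq
    using S by (intro emeasure_restrict_space) auto
qed

lemma emeasure_representing_UNIV: "emeasure representing_measure UNIV = ennreal (L (\<lambda>_. 1))"
proof -
  have "UNIV \<in> sets M"
    using sets.top[of M] space_V by simp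
  then show ?thesis
    using emeasure_representing_measure(2)[of UNIV] emeasure_strip[OF slab_strip(2)]
    unfolding slab_strip(1) by simp
qed

lemma finite_representing_measure: "finite_measure representing_measure"
proof
  show "emeasure representing_measure (space representing_measure) \<noteq> \<infinity>"
    using emeasure_representing_UNIV sets_eq_imp_space_eq[OF sets_representing_measure] space_V
    by simp
qed

section \<open>Integrals against the representing measure\<close>

lemma integrable_bounded:
  assumes "f \<in> V" "\<And>x. \<bar>f x\<bar> \<le> B"
  shows "integrable representing_measure f"
proof -
  interpret finite_measure representing_measure
    by (rule finite_representing_measure)
  show ?thesis
    using V_measurable[OF assms(1)] assms(2) by (intro integrable_const_bound[where B = B]) auto
qed

text \<open>It suffices to bound integrals from above: replacing \<open>u\<close> by \<open>1 - u\<close> gives the other inequality.\<close>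

lemma integral_le_L:
  assumes u: "u \<in> V" and u01: "\<And>x. 0 \<le> u x" "\<And>x. u x \<le> 1"
  shows "(\<integral>x. u x \<partial>representing_measure) \<le> L u"
proof -
  let ?\<mu> = representing_measure
  interpret finite_measure ?\<mu>
    by (rule finite_representing_measure)
  have u_meas [measurable]: "u \<in> borel_measurable ?\<mu>"
    using V_measurable[OF u] by simp
  have L1: "0 \<le> L (\<lambda>_. 1)"
    by (intro L_nonneg V_const) auto
  have *: "(\<integral>x. u x \<partial>?\<mu>) \<le> L u + L (\<lambda>_. 1) / real (Suc n)" for n
  proof -
    define h where "h = 1 / real (Suc n)"
    have h: "h > 0" "real (Suc n) * h = 1" by (auto simp: h_def)
    \<comment> \<open>\<open>F i\<close> is the slice of \<open>u\<close> between the levels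
      \<open>i h\<close> and \<open>(i + 1) h\<close>. The slices up to index \<open>n\<close> add
      up to \<open>u\<close>, since \<open>(n + 1) h = 1\<close> and \<open>u\<close> is at most
      1.\<close>
    define F where "F i x = min (u x) (real (Suc i) * h) - min (u x) (real i * h)" for i x
    have FV: "F i \<in> V" for i
      unfolding F_def using u by (intro V_intros)
    have FhV: "(\<lambda>x. F i x / h) \<in> V" for i
      using V_scale[OF FV, of "1 / h"] by simp
    have tele: "(\<Sum>i<m. F i x) = min (u x) (real m * h) - min (u x) 0" for m x
      by (induction m) (simp_all add: F_def)
    have F_nonneg: "0 \<le> F i x" for i x
      using h by (auto simp: F_def min_def algebra_simps)
    have level: "{x. real i * h < u x} \<in> sets ?\<mu>" for i
      using measurable_sets[OF u_meas, of "{real i * h<..}"] sets_eq_imp_space_eq[OF sets_representing_measure]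
        space_V by (simp add: vimage_def)
    have F_le: "F i x \<le> h * indicator {x. real i * h < u x} x" for i x
      using h by (auto simp: F_def min_def algebra_simps indicator_def)
    \<comment> \<open>Where \<open>u\<close> exceeds the upper level of a slice,
      \<open>F i / h\<close> equals 1; the cylinder over that set therefore lies in the strip below
      \<open>F i / h\<close>.\<close>
    have level_le: "h * measure ?\<mu> {x. real (Suc i) * h < u x} \<le> L (F i)" for i
    proof -
      let ?A = "{x. real (Suc i) * h < u x}"
      have "emeasure ?\<mu> ?A = emeasure strip_measure (?A \<times> {0..<1})"
        using level[of "Suc i"] by (intro emeasure_representing_measure) simp
      also have "\<dots> \<le> emeasure strip_measure (strip (\<lambda>_. 0) (\<lambda>x. F i x / h))"
      proof (rule emeasure_mono)
        show "strip (\<lambda>_. 0) (\<lambda>x. F i x / h) \<in> sets strip_measure"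
          using h F_nonneg by (intro strip_in_sets) (auto simp: bounds_def intro!: V_const FhV)
        have "F i x = h" if "x \<in> ?A" for x
          using that h by (auto simp: F_def min_def algebra_simps)
        then show "?A \<times> {0..<1} \<subseteq> strip (\<lambda>_. 0) (\<lambda>x. F i x / h)"
          using h by (auto simp: strip_def)
      qed
      also have "\<dots> = ennreal (L (\<lambda>x. F i x / h))"
        using h F_nonneg by (subst emeasure_strip) (auto simp: bounds_def intro!: V_const FhV)
      also have "\<dots> = ennreal (L (F i) / h)"
        using L_scale[OF FV, of "1 / h"] by simp
      finally have "measure ?\<mu> ?A \<le> L (F i) / h"
        using L_nonneg[OF FV F_nonneg, of i] h by (simp add: emeasure_eq_measure)
      then show ?thesis
        using h by (simp add: field_simps)
    qed
    have sum_le: "(\<Sum>i<n. L (F i)) \<le> L u"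
    proof -
      have "(\<Sum>i<n. L (F i)) = L (\<lambda>x. \<Sum>i<n. F i x)"
        by (simp add: L_sum FV)
      also have "\<dots> \<le> L u"
        using u01 by (intro L_mono V_sum FV u) (simp add: tele)
      finally show ?thesis .
    qed
    have "(\<integral>x. u x \<partial>?\<mu>) = (\<integral>x. (\<Sum>i<Suc n. F i x) \<partial>?\<mu>)"
      using u01 by (intro Bochner_Integration.integral_cong) (auto simp: tele h simp del: of_nat_Suc sum.lessThan_Suc)
    also have "\<dots> \<le> (\<integral>x. (\<Sum>i<Suc n. h * indicator {x. real i * h < u x} x) \<partial>?\<mu>)"
    proof (intro integral_mono sum_mono F_le)
      have "integrable ?\<mu> (F i)" for i
      proof (rule integrable_bounded[OF FV])
        show "\<bar>F i x\<bar> \<le> h" for x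
          using F_nonneg[of i x] F_le[of i x] h
          by (cases "real i * h < u x") (simp_all add: indicator_def)
      qed
      then show "integrable ?\<mu> (\<lambda>x. \<Sum>i<Suc n. F i x)"
        by (intro Bochner_Integration.integrable_sum)
      show "integrable ?\<mu> (\<lambda>x. \<Sum>i<Suc n. h * indicator {x. real i * h < u x} x)"
        using level by (intro Bochner_Integration.integrable_sum integrable_mult_right integrable_real_indicator)
          (auto simp: emeasure_eq_measure)
    qed
    also have "\<dots> = (\<Sum>i<Suc n. h * measure ?\<mu> {x. real i * h < u x})"
      using level by (subst Bochner_Integration.integral_sum)
        (auto simp: emeasure_eq_measure intro!: integrable_mult_right integrable_real_indicator)
    \<comment> \<open>A slice is bounded by its lower level set, while \<open>L\<close> of the slice
      bounds its upper one. The index shift leaves only the lowest term, at most \<open>h\<close>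
      times the total mass, which vanishes as \<open>n\<close> grows.\<close>
    also have "\<dots> = h * measure ?\<mu> {x. 0 < u x} + (\<Sum>i<n. h * measure ?\<mu> {x. real (Suc i) * h < u x})"
      by (subst sum.lessThan_Suc_shift) simp
    also have "\<dots> \<le> h * measure ?\<mu> UNIV + (\<Sum>i<n. L (F i))"
      using h finite_measure_mono[of "{x. 0 < u x}" UNIV] sets.top[of ?\<mu>]
        sets_eq_imp_space_eq[OF sets_representing_measure] space_V
      by (intro add_mono sum_mono level_le mult_left_mono) auto
    also have "measure ?\<mu> UNIV = L (\<lambda>_. 1)"
      using emeasure_representing_UNIV L1 by (simp add: emeasure_eq_measure)
    finally show ?thesis
      using sum_le by (simp add: h_def)
  qed
  have "(\<lambda>n. L u + L (\<lambda>_. 1) / real (Suc n)) \<longlonglongrightarrow> L u + 0"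
    by (intro tendsto_add tendsto_const LIMSEQ_Suc[OF lim_const_over_n])
  then show ?thesis
    using * by (intro LIMSEQ_le_const[where X = "\<lambda>n. L u + L (\<lambda>_. 1) / real (Suc n)"]) auto
qed

lemma integral_eq_L_unit:
  assumes u: "u \<in> V" and u01: "\<And>x. 0 \<le> u x" "\<And>x. u x \<le> 1"
  shows "(\<integral>x. u x \<partial>representing_measure) = L u"
proof -
  let ?\<mu> = representing_measure
  interpret finite_measure ?\<mu>
    by (rule finite_representing_measure)
  have sp: "space ?\<mu> = UNIV"
    using sets_eq_imp_space_eq[OF sets_representing_measure] space_V by simp
  have "integrable ?\<mu> u"
    using u01 by (intro integrable_bounded[OF u, of 1]) (simp add: abs_le_iff order_trans[of "- u _" 0])
  then have "(\<integral>x. 1 - u x \<partial>?\<mu>) = measure ?\<mu> UNIV - (\<integral>x. u x \<partial>?\<mu>)"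
    by (simp add: sp)
  moreover have "measure ?\<mu> UNIV = L (\<lambda>_. 1)"
    using emeasure_representing_UNIV L_nonneg[OF V_const, of 1] by (simp add: emeasure_eq_measure)
  moreover have "(\<integral>x. 1 - u x \<partial>?\<mu>) \<le> L (\<lambda>x. 1 - u x)"
    using u01 by (intro integral_le_L V_diff V_const u) auto
  moreover have "L (\<lambda>x. 1 - u x) = L (\<lambda>_. 1) - L u"
    by (rule L_diff[OF V_const u])
  ultimately show ?thesis
    using integral_le_L[OF assms] by simp
qed

text \<open>The truncations of \<open>f\<close> at \<open>Suc n\<close> are rescaled to the unit
  interval. What they cut off decreases to 0, so \<open>L_continuous\<close> identifies the limit of
  their values under \<open>L\<close>, and monotone convergence then gives integrability as
  well.\<close>

lemma integral_eq_L_nonneg: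
  assumes f: "f \<in> V" and f0: "\<And>x. 0 \<le> f x"
  shows "integrable representing_measure f" "(\<integral>x. f x \<partial>representing_measure) = L f"
proof -
  let ?\<mu> = representing_measure
  define g where "g n x = min (f x) (real (Suc n))" for n x
  have gV: "g n \<in> V" for n
    unfolding g_def using f by (intro V_intros)
  have gi: "integrable ?\<mu> (g n)" for n
  proof (rule integrable_bounded[OF gV])
    show "\<bar>g n x\<bar> \<le> real (Suc n)" for x
      using f0[of x] by (auto simp: g_def)
  qed
  have gL: "(\<integral>x. g n x \<partial>?\<mu>) = L (g n)" for n
  proof -
    let ?u = "\<lambda>x. (1 / real (Suc n)) * g n x"
    have "(\<integral>x. ?u x \<partial>?\<mu>) = L ?u"
      using f0 by (intro integral_eq_L_unit V_scale gV) (auto simp: g_def field_simps min_def)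
    then show ?thesis
      using L_scale[OF gV, of "1 / real (Suc n)" n] by (simp del: of_nat_Suc)
  qed
  have g_ev: "eventually (\<lambda>n. g n x = f x) sequentially" for x
  proof -
    obtain N where N: "f x \<le> real N" using real_arch_simple by blast
    show ?thesis
      using eventually_ge_at_top[of N] by eventually_elim (use N in \<open>auto simp: g_def\<close>)
  qed
  then have g_lim: "(\<lambda>n. g n x) \<longlonglongrightarrow> f x" for x
    by (simp add: tendsto_eventually)
  have "(\<lambda>n. L (\<lambda>x. f x - g n x)) \<longlonglongrightarrow> 0"
  proof (rule L_continuous)
    show "decseq (\<lambda>n. f x - g n x)" for x
      by (intro decseq_SucI) (auto simp: g_def)
    show "(\<lambda>n. f x - g n x) \<longlonglongrightarrow> 0" for x
      using tendsto_diff[OF tendsto_const g_lim, of "f x" x] by simp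
  qed (intro V_diff f gV)
  then have "(\<lambda>n. L f - L (g n)) \<longlonglongrightarrow> 0"
    by (simp add: L_diff f gV)
  from tendsto_diff[OF tendsto_const this, of "L f"]
  have lim: "(\<lambda>n. \<integral>x. g n x \<partial>?\<mu>) \<longlonglongrightarrow> L f"
    by (simp add: gL)
  have mono: "AE x in ?\<mu>. mono (\<lambda>n. g n x)"
    by (intro AE_I2 monoI) (auto simp: g_def min_def)
  have meas: "f \<in> borel_measurable ?\<mu>"
    using V_measurable[OF f] by simp
  show "integrable ?\<mu> f"
    by (rule integrable_monotone_convergence[OF gi mono _ lim meas]) (simp add: g_lim)
  show "(\<integral>x. f x \<partial>?\<mu>) = L f"
    by (rule integral_monotone_convergence[OF gi mono _ lim meas]) (simp add: g_lim)
qed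

theorem daniell_stone:
  assumes f: "f \<in> V"
  shows "integrable representing_measure f" "(\<integral>x. f x \<partial>representing_measure) = L f"
proof -
  let ?p = "\<lambda>x. max (f x) 0" and ?n = "\<lambda>x. max (- f x) 0"
  have V: "?p \<in> V" "?n \<in> V"
    using V_max[OF f V_const[of 0]] V_max[OF V_uminus[OF f] V_const[of 0]] by auto
  have f_eq: "(\<lambda>x. ?p x - ?n x) = f"
    by (rule ext) (simp add: max_def)
  have p: "integrable representing_measure ?p" "(\<integral>x. ?p x \<partial>representing_measure) = L ?p"
    by (rule integral_eq_L_nonneg[OF V(1)]; simp)+
  have n: "integrable representing_measure ?n" "(\<integral>x. ?n x \<partial>representing_measure) = L ?n"
    by (rule integral_eq_L_nonneg[OF V(2)]; simp)+
  show "integrable representing_measure f"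
    using Bochner_Integration.integrable_diff[OF p(1) n(1)] unfolding f_eq .
  show "(\<integral>x. f x \<partial>representing_measure) = L f"
    using Bochner_Integration.integral_diff[OF p(1) n(1)] L_diff[OF V] p(2) n(2)
    unfolding f_eq by simp
qed

end

section \<open>Compact fibres and measurability\<close>

text \<open>Total boundedness supplies finite nets of radius \<open>1 / Suc n\<close>. Their union
  reduces open conditions on the phase space to countably many points.\<close>

lemma compact_countable_dense:
  assumes "compact (UNIV :: 'a::metric_space set)"
  shows "\<exists>D :: 'a set. countable D \<and> closure D = UNIV"
proof -
  have "\<forall>n. \<exists>k. finite k \<and> k \<subseteq> UNIV \<and> (UNIV :: 'a set) \<subseteq> (\<Union>x\<in>k. ball x (1 / Suc n))"
    using assms unfolding compact_eq_totally_bounded by simp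
  then obtain k where k: "\<And>n. finite (k n)" "\<And>n. (UNIV :: 'a set) \<subseteq> (\<Union>x\<in>k n. ball x (1 / Suc n))"
    by metis
  have "x \<in> closure (\<Union>n. k n)" for x
    unfolding closure_approachable
  proof (intro allI impI)
    fix e :: real assume "e > 0"
    then obtain n where n: "1 / Suc n < e"
      using nat_approx_posE by blast
    have "x \<in> (\<Union>y\<in>k n. ball y (1 / Suc n))"
      using k(2)[of n] by blast
    then obtain y where "y \<in> k n" "dist y x < 1 / Suc n"
      by auto
    then show "\<exists>y\<in>\<Union>n. k n. dist y x < e"
      using n less_trans by blast
  qed
  then show ?thesis
    using k(1) by (intro exI[of _ "\<Union>n. k n"]) (auto intro: countable_finite)
qed

lemma dense_open_meets:
  assumes "closure D = UNIV" "open U" "x \<in> U"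
  shows "\<exists>d\<in>D. d \<in> U"
  using assms open_Int_closure_eq_empty[of U D] by fastforce

lemma open_less_continuous:
  fixes g :: "'a::topological_space \<Rightarrow> real"
  assumes "continuous_on UNIV g"
  shows "open {z. g z < c}" "open {z. c < g z}"
  using assms by (auto intro!: open_Collect_less continuous_intros)

text \<open>Tychonoff's theorem; sequences hold point configurations of every finite size in one
  compact space.\<close>

lemma compact_sequences:
  assumes "compact (UNIV :: 'a::metric_space set)"
  shows "compact (UNIV :: (nat \<Rightarrow> 'a) set)"
proof -
  have "compact_space (euclidean :: 'a topology)"
    using assms by (simp add: compact_space_def)
  then have "compact_space (product_topology (\<lambda>_. euclidean :: 'a topology) (UNIV :: nat set))"
    by (simp add: compact_space_product_topology)
  then have "compact_space (euclidean :: (nat \<Rightarrow> 'a) topology)"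
    by (simp add: euclidean_product_topology)
  then show ?thesis
    by (simp add: compact_space_def)
qed

text \<open>On a compact space a nonnegative continuous function has a zero iff it is arbitrarily small
  on a countable dense set; this replaces the measurable projection theorem.\<close>

lemma measurable_ex_zero:
  fixes g :: "'w \<Rightarrow> 'a::metric_space \<Rightarrow> real"
  assumes cpt: "compact (UNIV :: 'a set)"
    and meas: "\<And>z. (\<lambda>\<omega>. g \<omega> z) \<in> borel_measurable M"
    and cont: "\<And>\<omega>. \<omega> \<in> space M \<Longrightarrow> continuous_on UNIV (g \<omega>)"
    and nonneg: "\<And>\<omega> z. 0 \<le> g \<omega> z"
  shows "{\<omega> \<in> space M. \<exists>z. g \<omega> z = 0} \<in> sets M"
proof -
  obtain D :: "'a set" where D: "countable D" "closure D = UNIV"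
    using compact_countable_dense[OF cpt] by blast
  have "(\<exists>z. g \<omega> z = 0) \<longleftrightarrow> (\<forall>n. \<exists>z\<in>D. g \<omega> z < 1 / Suc n)" if \<omega>: "\<omega> \<in> space M" for \<omega>
  proof
    assume "\<exists>z. g \<omega> z = 0"
    then obtain z where z: "g \<omega> z = 0" by blast
    show "\<forall>n. \<exists>z\<in>D. g \<omega> z < 1 / Suc n"
    proof
      fix n show "\<exists>z\<in>D. g \<omega> z < 1 / Suc n"
        using dense_open_meets[OF D(2) open_less_continuous(1)[OF cont[OF \<omega>]], of z "1 / Suc n"] z
        by auto
    qed
  next
    assume *: "\<forall>n. \<exists>z\<in>D. g \<omega> z < 1 / Suc n"
    obtain z0 where z0: "\<And>z. g \<omega> z0 \<le> g \<omega> z"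
      using continuous_attains_inf[OF cpt _ cont[OF \<omega>]] by auto
    have "\<not> 0 < g \<omega> z0"
    proof
      assume "0 < g \<omega> z0"
      then obtain n where "1 / Suc n < g \<omega> z0" using nat_approx_posE by blast
      then show False using * z0 by (meson less_trans not_less)
    qed
    then show "\<exists>z. g \<omega> z = 0"
      using nonneg[of \<omega> z0] by (intro exI[of _ z0]) linarith
  qed
  then have "{\<omega> \<in> space M. \<exists>z. g \<omega> z = 0} = {\<omega> \<in> space M. \<forall>n. \<exists>z\<in>D. g \<omega> z < 1 / Suc n}"
    by blast
  also have "\<dots> \<in> sets M"
    using D(1) meas by measurable
  finally show ?thesis .
qed

text \<open>Distances to fixed points are Borel, so \<open>dist x y < c\<close> is split over a
  countable dense set: the triangle inequality gives one direction, points near \<open>y\<close> the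
  other.\<close>

lemma borel_measurable_dist_compact:
  fixes a b :: "'w \<Rightarrow> 'a::metric_space"
  assumes cpt: "compact (UNIV :: 'a set)"
    and [measurable]: "a \<in> borel_measurable M" "b \<in> borel_measurable M"
  shows "(\<lambda>\<omega>. dist (a \<omega>) (b \<omega>)) \<in> borel_measurable M"
proof (rule borel_measurableI_less)
  fix c
  obtain D :: "'a set" where D: "countable D" "closure D = UNIV"
    using compact_countable_dense[OF cpt] by blast
  have "dist x y < c \<longleftrightarrow> (\<exists>d\<in>D. dist x d + dist y d < c)" for x y :: 'a
  proof
    assume "dist x y < c"
    have "open {d. dist x d + dist y d < c}"
      by (intro open_less_continuous continuous_intros)
    from dense_open_meets[OF D(2) this, of y] show "\<exists>d\<in>D. dist x d + dist y d < c"
      using \<open>dist x y < c\<close> by simp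
  next
    assume "\<exists>d\<in>D. dist x d + dist y d < c"
    then obtain d where "dist x d + dist y d < c" by blast
    then show "dist x y < c"
      using dist_triangle2[of x y d] by simp
  qed
  then have "{\<omega> \<in> space M. dist (a \<omega>) (b \<omega>) < c} = {\<omega> \<in> space M. \<exists>d\<in>D. dist (a \<omega>) d + dist (b \<omega>) d < c}"
    by blast
  also have "\<dots> \<in> sets M"
  proof -
    have [measurable]: "(\<lambda>x. dist x d) \<in> borel_measurable borel" for d :: 'a
      by (intro borel_measurable_continuous_onI continuous_intros)
    show ?thesis
      using D(1) by measurable
  qed
  finally show "{\<omega> \<in> space M. dist (a \<omega>) (b \<omega>) < c} \<in> sets M" .
qed

text \<open>The open sets where \<open>f n\<close> is below \<open>e\<close> grow with
  \<open>n\<close> and cover the space; the largest index of a finite subcover works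
  uniformly.\<close>

lemma dini_decreasing:
  fixes f :: "nat \<Rightarrow> 'a::metric_space \<Rightarrow> real"
  assumes cpt: "compact (UNIV :: 'a set)"
    and cont: "\<And>n. continuous_on UNIV (f n)"
    and dec: "\<And>x. decseq (\<lambda>n. f n x)"
    and lim: "\<And>x. (\<lambda>n. f n x) \<longlonglongrightarrow> 0"
    and e: "e > 0"
  shows "\<exists>N. \<forall>n\<ge>N. \<forall>x. f n x < e"
proof -
  have "UNIV \<subseteq> (\<Union>n\<in>UNIV. {x. f n x < e})"
  proof
    fix x
    show "x \<in> (\<Union>n\<in>UNIV. {x. f n x < e})"
      using order_tendstoD(2)[OF lim[of x] e] by (auto simp: eventually_sequentially)
  qed
  then obtain C where C: "finite C" "UNIV \<subseteq> (\<Union>n\<in>C. {x. f n x < e})"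
    by (rule compactE_image[OF cpt open_less_continuous(1)[OF cont]])
  have "f n x < e" if "n \<ge> Max C" for n x
  proof -
    obtain m where m: "m \<in> C" "f m x < e" using C(2) by blast
    then have "m \<le> n"
      using that Max_ge[OF C(1) m(1)] by simp
    then show ?thesis
      using m(2) decseqD[OF dec[of x], of m n] by simp
  qed
  then show ?thesis by blast
qed

section \<open>Random systems and the lattice of fibrewise continuous functions\<close>

locale random_system =
  fixes P :: "'w measure" and \<theta> :: "'w \<Rightarrow> 'w" and T :: "'w \<Rightarrow> 'x::metric_space \<Rightarrow> 'x"
  assumes space_P: "space P = UNIV"
    and system: "measure_preserving_system P \<theta>"
    and compact_X: "compact (UNIV :: 'x set)"
    and maps: "random_maps P T"
begin

sublocale prob_space P
  using system by (simp add: measure_preserving_system_def)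

lemma shift_measurable [measurable]: "\<theta> \<in> measurable P P"
  using system by (simp add: measure_preserving_system_def)

lemma shift_power_measurable [measurable]: "(\<theta> ^^ n) \<in> measurable P P"
  by (induction n) auto

lemma distr_shift_power: "distr P P (\<theta> ^^ n) = P"
proof (induction n)
  case 0
  then show ?case by (simp add: distr_id id_def)
next
  case (Suc n)
  have "distr P P (\<theta> ^^ Suc n) = distr (distr P P (\<theta> ^^ n)) P \<theta>"
    by (subst distr_distr) auto
  also have "\<dots> = P"
    using Suc system by (simp add: measure_preserving_system_def)
  finally show ?case .
qed

lemma integral_shift_power:
  fixes u :: "'w \<Rightarrow> real"
  assumes "integrable P u"
  shows "integrable P (\<lambda>\<omega>. u ((\<theta> ^^ n) \<omega>))" "(\<integral>\<omega>. u ((\<theta> ^^ n) \<omega>) \<partial>P) = (\<integral>\<omega>. u \<omega> \<partial>P)"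
proof -
  have [measurable]: "u \<in> borel_measurable P"
    using assms by auto
  show "integrable P (\<lambda>\<omega>. u ((\<theta> ^^ n) \<omega>))"
    using assms integrable_distr_eq[of "\<theta> ^^ n" P P u] by (simp add: distr_shift_power)
  show "(\<integral>\<omega>. u ((\<theta> ^^ n) \<omega>) \<partial>P) = (\<integral>\<omega>. u \<omega> \<partial>P)"
    using integral_distr[of "\<theta> ^^ n" P P u] by (simp add: distr_shift_power)
qed

lemma T_continuous: "continuous_on UNIV (T \<omega>)"
  using maps space_P by (simp add: random_maps_def)

lemma T_measurable: "(\<lambda>(\<omega>, x). T \<omega> x) \<in> measurable (P \<Otimes>\<^sub>M borel) borel"
  using maps by (simp add: random_maps_def)

lemma skew_product_measurable [measurable]:
  "skew_product \<theta> T \<in> measurable (P \<Otimes>\<^sub>M borel) (P \<Otimes>\<^sub>M borel)"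
  unfolding skew_product_def case_prod_unfold
  using T_measurable[unfolded case_prod_unfold] by (intro measurable_Pair) auto

lemma iter_continuous: "continuous_on UNIV (iter \<theta> T n \<omega>)"
proof (induction n)
  case (Suc n)
  then show ?case
    using continuous_on_compose2[OF T_continuous Suc] by (simp add: comp_def)
qed (simp add: id_def)

lemma iter_measurable_pair: "(\<lambda>z. iter \<theta> T n (fst z) (snd z)) \<in> measurable (P \<Otimes>\<^sub>M borel) borel"
proof (induction n)
  case (Suc n)
  have "(\<lambda>z. ((\<theta> ^^ n) (fst z), iter \<theta> T n (fst z) (snd z))) \<in> measurable (P \<Otimes>\<^sub>M borel) (P \<Otimes>\<^sub>M borel)"
    using Suc by (intro measurable_Pair) auto
  from measurable_compose[OF this T_measurable] show ?case
    by simp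
qed simp

lemma pair_iter_measurable:
  "(\<lambda>\<omega>. ((\<theta> ^^ n) \<omega>, iter \<theta> T n \<omega> y)) \<in> measurable P (P \<Otimes>\<^sub>M borel)"
proof (intro measurable_Pair)
  have "(\<lambda>\<omega>. (\<omega>, y)) \<in> measurable P (P \<Otimes>\<^sub>M borel)"
    by simp
  from measurable_compose[OF this iter_measurable_pair]
  show "(\<lambda>\<omega>. iter \<theta> T n \<omega> y) \<in> measurable P borel"
    by simp
qed auto

lemma iter_measurable: "(\<lambda>\<omega>. iter \<theta> T n \<omega> y) \<in> measurable P borel"
  using measurable_compose[OF pair_iter_measurable measurable_snd] by simp

lemma iter_dist_measurable:
  "(\<lambda>\<omega>. dist (iter \<theta> T n \<omega> y) (iter \<theta> T n \<omega> y')) \<in> borel_measurable P"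
  by (intro borel_measurable_dist_compact compact_X iter_measurable)

lemma L1_C_measurable: "f \<in> L1_C P \<Longrightarrow> f \<in> borel_measurable (P \<Otimes>\<^sub>M borel)"
  by (simp add: L1_C_def)

lemma L1_C_continuous: "f \<in> L1_C P \<Longrightarrow> continuous_on UNIV (\<lambda>x. f (\<omega>, x))"
  by (simp add: L1_C_def space_P)

lemma birkhoff_sum_measurable:
  assumes "f \<in> L1_C P"
  shows "(\<lambda>\<omega>. birkhoff_sum \<theta> T f n \<omega> y) \<in> borel_measurable P"
  unfolding birkhoff_sum_def
  by (intro borel_measurable_sum measurable_compose[OF pair_iter_measurable L1_C_measurable[OF assms]])

lemma birkhoff_sum_continuous:
  assumes "f \<in> L1_C P"
  shows "continuous_on UNIV (birkhoff_sum \<theta> T f n \<omega>)"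
  unfolding birkhoff_sum_def
  by (intro continuous_on_sum continuous_on_compose2[OF L1_C_continuous[OF assms] iter_continuous]) auto

lemma birkhoff_sum_linear:
  "birkhoff_sum \<theta> T (\<lambda>z. s * f z + t * g z) n \<omega> x =
    s * birkhoff_sum \<theta> T f n \<omega> x + t * birkhoff_sum \<theta> T g n \<omega> x"
  by (simp add: birkhoff_sum_def sum.distrib sum_distrib_left)

text \<open>The integral of \<open>sup_abs f\<close> is the norm of \<open>f\<close>; a real-valued
  version is needed for the Bochner integral.\<close>

definition sup_abs :: "('w \<times> 'x \<Rightarrow> real) \<Rightarrow> 'w \<Rightarrow> real" where
  "sup_abs f \<omega> = (SUP x. \<bar>f (\<omega>, x)\<bar>)"

lemma bdd_above_abs:
  fixes f :: "'w \<times> 'x \<Rightarrow> real"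
  assumes "f \<in> L1_C P"
  shows "bdd_above (range (\<lambda>x. \<bar>f (\<omega>, x)\<bar>))"
  by (rule bounded_imp_bdd_above[OF compact_imp_bounded[OF
      compact_continuous_image[OF continuous_on_rabs[OF L1_C_continuous[OF assms]] compact_X]]])

lemma abs_le_sup_abs: "f \<in> L1_C P \<Longrightarrow> \<bar>f (\<omega>, x)\<bar> \<le> sup_abs f \<omega>"
  unfolding sup_abs_def by (intro cSUP_upper bdd_above_abs) auto

lemma sup_abs_nonneg: "f \<in> L1_C P \<Longrightarrow> 0 \<le> sup_abs f \<omega>"
  using abs_le_sup_abs[of f \<omega>] abs_ge_zero order_trans by blast

lemma integrable_sup_abs:
  assumes f: "f \<in> L1_C P"
  shows "integrable P (sup_abs f)"
proof (rule integrableI_nonneg)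
  note meas = L1_C_measurable[OF f] 
  obtain D :: "'x set" where D: "countable D" "closure D = UNIV"
    using compact_countable_dense[OF compact_X] by blast
  show "sup_abs f \<in> borel_measurable P"
  proof (rule borel_measurableI_greater)
    fix c
    have "c < sup_abs f \<omega> \<longleftrightarrow> (\<exists>x\<in>D. c < \<bar>f (\<omega>, x)\<bar>)" for \<omega>
    proof -
      have "c < sup_abs f \<omega> \<longleftrightarrow> (\<exists>x. c < \<bar>f (\<omega>, x)\<bar>)"
        unfolding sup_abs_def using bdd_above_abs[OF f] by (subst less_cSUP_iff) auto
      also have "\<dots> \<longleftrightarrow> (\<exists>x\<in>D. c < \<bar>f (\<omega>, x)\<bar>)"
        using dense_open_meets[OF D(2) open_less_continuous(2)[OF continuous_on_rabs[OF L1_C_continuous[OF f]]], of _ c \<omega>]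
        by auto
      finally show ?thesis .
    qed
    then have "{\<omega> \<in> space P. c < sup_abs f \<omega>} = {\<omega> \<in> space P. \<exists>x\<in>D. c < \<bar>f (\<omega>, x)\<bar>}"
      by blast
    also have "\<dots> \<in> sets P"
      using D(1) meas by measurable
    finally show "{\<omega> \<in> space P. c < sup_abs f \<omega>} \<in> sets P" .
  qed
  have "ennreal (sup_abs f \<omega>) \<le> (SUP x. ennreal \<bar>f (\<omega>, x)\<bar>)" for \<omega>
  proof -
    obtain y where y: "\<And>x. \<bar>f (\<omega>, x)\<bar> \<le> \<bar>f (\<omega>, y)\<bar>"
      using continuous_attains_sup[OF compact_X _ continuous_on_rabs[OF L1_C_continuous[OF f]], of \<omega>]
      by auto
    then have "sup_abs f \<omega> \<le> \<bar>f (\<omega>, y)\<bar>"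
      unfolding sup_abs_def by (intro cSUP_least) auto
    then show ?thesis
      by (meson SUP_upper2 UNIV_I ennreal_leI)
  qed
  then have "(\<integral>\<^sup>+ \<omega>. ennreal (sup_abs f \<omega>) \<partial>P) \<le> (\<integral>\<^sup>+ \<omega>. (SUP x. ennreal \<bar>f (\<omega>, x)\<bar>) \<partial>P)"
    by (intro nn_integral_mono)
  also have "\<dots> < \<infinity>"
    using f by (simp add: L1_C_def)
  finally show "(\<integral>\<^sup>+ \<omega>. ennreal (sup_abs f \<omega>) \<partial>P) < \<infinity>" .
qed (use sup_abs_nonneg[OF f] in simp)

lemma L1_CI:
  assumes "f \<in> borel_measurable (P \<Otimes>\<^sub>M borel)" "\<And>\<omega>. continuous_on UNIV (\<lambda>x. f (\<omega>, x))"
    and u: "integrable P u" "\<And>\<omega> x. \<bar>f (\<omega>, x)\<bar> \<le> u \<omega>"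
  shows "f \<in> L1_C P"
proof -
  have "(\<integral>\<^sup>+ \<omega>. (SUP x. ennreal \<bar>f (\<omega>, x)\<bar>) \<partial>P) \<le> (\<integral>\<^sup>+ \<omega>. ennreal (norm (u \<omega>)) \<partial>P)"
    using u(2) by (intro nn_integral_mono SUP_least ennreal_leI) (simp add: order_trans[OF _ abs_ge_self])
  also have "\<dots> < \<infinity>"
    using u(1) by (simp add: integrable_iff_bounded)
  finally show ?thesis
    using assms by (simp add: L1_C_def)
qed

lemma L1_C_fst:
  assumes "integrable P c"
  shows "(\<lambda>z :: 'w \<times> 'x. c (fst z)) \<in> L1_C P"
proof (rule L1_CI[of _ "\<lambda>\<omega>. \<bar>c \<omega>\<bar>"])
  have [measurable]: "c \<in> borel_measurable P" using assms by auto
  show "(\<lambda>z :: 'w \<times> 'x. c (fst z)) \<in> borel_measurable (P \<Otimes>\<^sub>M borel)" by measurable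
qed (use assms in auto)

text \<open>With the complement of a proper open set as \<open>S\<close>, the positivity set is the
  cylinder over that open set; the Borel sets of the phase space are generated in this way.\<close>

lemma L1_C_infdist: "(\<lambda>z :: 'w \<times> 'x. infdist (snd z) S) \<in> L1_C P"
proof -
  have c: "continuous_on UNIV (\<lambda>x. infdist x S)"
    by (intro continuous_intros)
  obtain B where B: "\<And>x. \<bar>infdist x S\<bar> \<le> B"
    using compact_imp_bounded[OF compact_continuous_image[OF c compact_X]]
    by (auto simp: bounded_iff)
  have [measurable]: "(\<lambda>x. infdist x S) \<in> borel_measurable borel"
    using c by (rule borel_measurable_continuous_onI)
  show ?thesis
    by (rule L1_CI[of _ "\<lambda>_. B"]) (use c B in auto)
qed

lemma L1_C_skew_product:
  assumes g: "g \<in> L1_C P"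
  shows "(\<lambda>z. g (skew_product \<theta> T z)) \<in> L1_C P"
proof (rule L1_CI)
  show "(\<lambda>z. g (skew_product \<theta> T z)) \<in> borel_measurable (P \<Otimes>\<^sub>M borel)"
    by (rule measurable_compose[OF skew_product_measurable L1_C_measurable[OF g]])
  show "continuous_on UNIV (\<lambda>x. g (skew_product \<theta> T (\<omega>, x)))" for \<omega>
    unfolding skew_product_def
    using continuous_on_compose2[OF L1_C_continuous[OF g] T_continuous] by simp
  show "integrable P (\<lambda>\<omega>. sup_abs g ((\<theta> ^^ 1) \<omega>))"
    by (intro integral_shift_power integrable_sup_abs g)
  show "\<bar>g (skew_product \<theta> T (\<omega>, x))\<bar> \<le> sup_abs g ((\<theta> ^^ 1) \<omega>)" for \<omega> x
    using abs_le_sup_abs[OF g] by (simp add: skew_product_def)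
qed

text \<open>The substantial point is the generation of the product \<sigma>-algebra: indicators of
  measurable sets of \<omega> make the first projection measurable for the generated
  \<sigma>-algebra, distance functions the second. The reverse inclusion is the measurability of the
  members.\<close>

sublocale L1: vector_lattice "L1_C P" "P \<Otimes>\<^sub>M borel :: ('w \<times> 'x) measure"
proof
  fix f g :: "'w \<times> 'x \<Rightarrow> real" assume f: "f \<in> L1_C P" and g: "g \<in> L1_C P"
  note [measurable] = L1_C_measurable[OF f] L1_C_measurable[OF g]
  show "(\<lambda>x. f x + g x) \<in> L1_C P"
  proof (rule L1_CI)
    show "integrable P (\<lambda>\<omega>. sup_abs f \<omega> + sup_abs g \<omega>)"
      by (intro Bochner_Integration.integrable_add integrable_sup_abs f g)
    show "\<bar>f (\<omega>, x) + g (\<omega>, x)\<bar> \<le> sup_abs f \<omega> + sup_abs g \<omega>" for \<omega> x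
      using abs_le_sup_abs[OF f, of \<omega> x] abs_le_sup_abs[OF g, of \<omega> x] by linarith
    show "continuous_on UNIV (\<lambda>x. f (\<omega>, x) + g (\<omega>, x))" for \<omega>
      by (intro continuous_on_add L1_C_continuous f g)
  qed measurable
next
  fix f :: "'w \<times> 'x \<Rightarrow> real" and c :: real assume f: "f \<in> L1_C P"
  note [measurable] = L1_C_measurable[OF f]
  show "(\<lambda>x. c * f x) \<in> L1_C P"
  proof (rule L1_CI)
    show "integrable P (\<lambda>\<omega>. \<bar>c\<bar> * sup_abs f \<omega>)"
      by (intro integrable_mult_right integrable_sup_abs f)
    show "\<bar>c * f (\<omega>, x)\<bar> \<le> \<bar>c\<bar> * sup_abs f \<omega>" for \<omega> x
      using abs_le_sup_abs[OF f, of \<omega> x] by (simp add: abs_mult mult_left_mono)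
    show "continuous_on UNIV (\<lambda>x. c * f (\<omega>, x))" for \<omega>
      by (intro continuous_on_mult continuous_on_const L1_C_continuous f)
  qed measurable
  show "(\<lambda>x. \<bar>f x\<bar>) \<in> L1_C P"
  proof (rule L1_CI)
    show "integrable P (sup_abs f)"
      by (rule integrable_sup_abs[OF f])
    show "\<bar>\<bar>f (\<omega>, x)\<bar>\<bar> \<le> sup_abs f \<omega>" for \<omega> x
      using abs_le_sup_abs[OF f] by simp
    show "continuous_on UNIV (\<lambda>x. \<bar>f (\<omega>, x)\<bar>)" for \<omega>
      by (intro continuous_on_rabs L1_C_continuous f)
  qed measurable
next
  show "(\<lambda>_ :: 'w \<times> 'x. c) \<in> L1_C P" for c
    using L1_C_fst[of "\<lambda>_. c"] by simp
  let ?E = "{{z. 0 < f z} |f. f \<in> L1_C P} :: ('w \<times> 'x) set set"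
  let ?N = "sigma UNIV ?E"
  have E: "{z. 0 < f z} \<in> sets ?N" if "f \<in> L1_C P" for f :: "'w \<times> 'x \<Rightarrow> real"
    using that by (auto intro!: sigma_sets.Basic)
  have "fst \<in> measurable ?N P"
  proof (rule measurableI)
    fix A assume A: "A \<in> sets P"
    have eq: "{z. 0 < (indicator A (fst z) :: real)} = (fst -` A :: ('w \<times> 'x) set)"
      by (auto simp: indicator_def split: if_splits)
    have int: "integrable P (indicator A :: 'w \<Rightarrow> real)"
      using A by (intro integrable_real_indicator) (auto simp: emeasure_eq_measure)
    show "fst -` A \<inter> space ?N \<in> sets ?N"
      using E[OF L1_C_fst[OF int]] unfolding eq by (simp add: space_measure_of_conv)
  qed (simp add: space_P)
  moreover have "snd \<in> measurable ?N borel"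
  proof (rule borel_measurableI)
    fix U :: "'x set" assume U: "open U"
    show "snd -` U \<inter> space ?N \<in> sets ?N"
    \<comment> \<open>\<open>infdist\<close> to the empty set is 0, so the whole space is treated
      apart.\<close>
    proof (cases "U = UNIV")
      case True
      then show ?thesis
        using sets.top[of ?N] by (simp add: space_measure_of_conv)
    next
      case False
      have "0 < infdist x (- U) \<longleftrightarrow> x \<in> U" for x
        using in_closed_iff_infdist_zero[of "- U" x] infdist_nonneg[of x "- U"] U False
        by (auto simp: less_le)
      then have "snd -` U = {z :: 'w \<times> 'x. 0 < infdist (snd z) (- U)}"
        by auto
      then show ?thesis
        using E[OF L1_C_infdist[of "- U"]] by (simp add: space_measure_of_conv)
    qed
  qed
  ultimately have id: "(\<lambda>z. (fst z, snd z)) \<in> measurable ?N (P \<Otimes>\<^sub>M borel)"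
    by (intro measurable_Pair)
  show "sets (P \<Otimes>\<^sub>M borel) = sigma_sets UNIV ?E"
  proof (intro equalityI subsetI)
    fix A assume "A \<in> sets (P \<Otimes>\<^sub>M (borel :: 'x measure))"
    from measurable_sets[OF id this] show "A \<in> sigma_sets UNIV ?E"
      by (simp add: space_measure_of_conv)
  next
    fix A assume A: "A \<in> sigma_sets UNIV ?E"
    have sp: "space (P \<Otimes>\<^sub>M (borel :: 'x measure)) = UNIV"
      by (simp add: space_pair_measure space_P)
    have "{z. 0 < f z} \<in> sets (P \<Otimes>\<^sub>M borel)" if "f \<in> L1_C P" for f :: "'w \<times> 'x \<Rightarrow> real"
      using measurable_sets[OF L1_C_measurable[OF that], of "{0<..}"] by (simp add: sp vimage_def)
    then have "?E \<subseteq> sets (P \<Otimes>\<^sub>M borel)" by blast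
    then have "sigma_sets (space (P \<Otimes>\<^sub>M (borel :: 'x measure))) ?E \<subseteq> sets (P \<Otimes>\<^sub>M borel)"
      by (rule sets.sigma_sets_subset)
    then show "A \<in> sets (P \<Otimes>\<^sub>M borel)"
      using A sp by auto
  qed
qed

text \<open>The decrease is uniform on each fibre, and \<open>sup_abs (F 0)\<close> dominates. A
  positive functional that integrates functions of \<omega> alone against \<open>P\<close> inherits
  its continuity from this.\<close>

lemma sup_abs_tendsto_zero:
  assumes F: "\<And>n::nat. F n \<in> L1_C P" and dec: "\<And>z. decseq (\<lambda>n. F n z)"
    and lim: "\<And>z. (\<lambda>n. F n z) \<longlonglongrightarrow> 0"
  shows "(\<lambda>n. \<integral>\<omega>. sup_abs (F n) \<omega> \<partial>P) \<longlonglongrightarrow> 0"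
proof -
  have nonneg: "0 \<le> F n z" for n z
    using decseq_ge[OF dec lim] .
  have "(\<lambda>n. \<integral>\<omega>. sup_abs (F n) \<omega> \<partial>P) \<longlonglongrightarrow> (\<integral>\<omega>. 0 \<partial>P)"
  proof (rule integral_dominated_convergence[where w = "sup_abs (F 0)"])
    show "AE \<omega> in P. (\<lambda>n. sup_abs (F n) \<omega>) \<longlonglongrightarrow> 0"
    proof (intro AE_I2 LIMSEQ_I)
      fix \<omega> and r :: real assume "0 < r"
      then have "\<exists>N. \<forall>n\<ge>N. \<forall>x. F n (\<omega>, x) < r / 2"
        using dec lim L1_C_continuous[OF F] by (intro dini_decreasing[OF compact_X]) auto
      then obtain N where N: "\<And>n x. n \<ge> N \<Longrightarrow> F n (\<omega>, x) < r / 2"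
        by blast
      have "norm (sup_abs (F n) \<omega> - 0) < r" if "n \<ge> N" for n
      proof -
        have "sup_abs (F n) \<omega> \<le> r / 2"
          unfolding sup_abs_def using N[OF that] nonneg by (intro cSUP_least) (auto intro: less_imp_le)
        then show ?thesis
          using sup_abs_nonneg[OF F, of n \<omega>] \<open>0 < r\<close> by simp
      qed
      then show "\<exists>N. \<forall>n\<ge>N. norm (sup_abs (F n) \<omega> - 0) < r" by blast
    qed
    show "AE \<omega> in P. norm (sup_abs (F n) \<omega>) \<le> sup_abs (F 0) \<omega>" for n
    proof (intro AE_I2)
      fix \<omega>
      have "\<bar>F n (\<omega>, x)\<bar> \<le> sup_abs (F 0) \<omega>" for x
        using nonneg[of n "(\<omega>, x)"] nonneg[of 0 "(\<omega>, x)"] decseqD[OF dec, of 0 n "(\<omega>, x)"]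
          abs_le_sup_abs[OF F, of 0 \<omega> x] by simp
      then have "sup_abs (F n) \<omega> \<le> sup_abs (F 0) \<omega>"
        unfolding sup_abs_def[of "F n"] by (intro cSUP_least) auto
      then show "norm (sup_abs (F n) \<omega>) \<le> sup_abs (F 0) \<omega>"
        using sup_abs_nonneg[OF F, of n \<omega>] by simp
    qed
  qed (use integrable_sup_abs[OF F] in auto)
  then show ?thesis by simp
qed

end

section \<open>Integrals of extended real functions and partition functions\<close>

lemma ereal_integral_mono:
  assumes "\<And>\<omega>. \<phi> \<omega> \<le> \<psi> \<omega>"
  shows "ereal_integral M \<phi> \<le> ereal_integral M \<psi>"
  unfolding ereal_integral_def using assms
  by (intro ereal_minus_mono) (auto simp: less_eq_ennreal.rep_eq[symmetric] intro!: nn_integral_mono e2ennreal_mono)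

text \<open>The second form needs no exclusion of infinite values: \<infinity> for \<open>a\<close>
  or \<open>b\<close> makes the right side infinite, and otherwise -\<infinity> for one of them
  forces \<open>c = -\<infinity>\<close>, whose negative part is infinite.\<close>

lemma e2ennreal_combination:
  fixes a b c :: ereal and s t :: real
  assumes s: "s > 0" and t: "t > 0" and le: "c \<le> ereal s * a + ereal t * b"
  shows "e2ennreal c \<le> ennreal s * e2ennreal a + ennreal t * e2ennreal b"
    and "e2ennreal c + (ennreal s * e2ennreal (- a) + ennreal t * e2ennreal (- b))
      \<le> e2ennreal (- c) + (ennreal s * e2ennreal a + ennreal t * e2ennreal b)"
proof -
  have mult: "ennreal q * ennreal r = ennreal (q * max 0 r)" if "q > 0" for q r
    using that by (cases "0 \<le> r") (simp_all add: ennreal_mult ennreal_neg)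
  consider "a = \<infinity> \<or> b = \<infinity>" | "a \<noteq> \<infinity>" "b \<noteq> \<infinity>" "a = - \<infinity> \<or> b = - \<infinity>"
    | "\<bar>a\<bar> \<noteq> \<infinity>" "\<bar>b\<bar> \<noteq> \<infinity>" by auto
  then have "e2ennreal c \<le> ennreal s * e2ennreal a + ennreal t * e2ennreal b \<and>
      e2ennreal c + (ennreal s * e2ennreal (- a) + ennreal t * e2ennreal (- b))
      \<le> e2ennreal (- c) + (ennreal s * e2ennreal a + ennreal t * e2ennreal b)"
  proof cases
    case 1
    then have top: "ennreal s * e2ennreal a + ennreal t * e2ennreal b = top"
      using s t by (auto simp: ennreal_mult_top)
    show ?thesis unfolding top by simp
  next
    case 2
    then have "c = - \<infinity>"
      using le s t by (cases rule: ereal2_cases[of a b]) auto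
    then show ?thesis by (simp add: e2ennreal_neg)
  next
    case 3
    then obtain a' b' where ab: "a = ereal a'" "b = ereal b'" by auto
    show ?thesis
    proof (cases c)
      case (real c')
      have c': "c' \<le> s * a' + t * b'"
        using le by (simp add: ab real)
      have m: "max 0 r - max 0 (- r) = r" for r :: real by (simp add: max_def)
      have c1: "max 0 c' \<le> s * max 0 a' + t * max 0 b'"
      proof -
        have "s * a' \<le> s * max 0 a'" "t * b' \<le> t * max 0 b'"
          using s t by (auto intro!: mult_left_mono)
        moreover have "0 \<le> s * max 0 a'" "0 \<le> t * max 0 b'"
          using s t by auto
        ultimately show ?thesis using c' by linarith
      qed
      have c2: "max 0 c' + (s * max 0 (- a') + t * max 0 (- b'))
          \<le> max 0 (- c') + (s * max 0 a' + t * max 0 b')"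
      proof -
        have "s * max 0 a' - s * max 0 (- a') = s * a'" "t * max 0 b' - t * max 0 (- b') = t * b'"
          using m by (simp_all add: right_diff_distrib[symmetric])
        then show ?thesis using c' m[of c'] by linarith
      qed
      show ?thesis
      proof
        have "e2ennreal c \<le> ennreal (s * max 0 a' + t * max 0 b')"
          unfolding real e2ennreal_ereal using c1 by (intro ennreal_leI) simp
        then show "e2ennreal c \<le> ennreal s * e2ennreal a + ennreal t * e2ennreal b"
          unfolding ab e2ennreal_ereal mult[OF s] mult[OF t] using s t by simp
        have "ennreal (max 0 c' + (s * max 0 (- a') + t * max 0 (- b')))
            \<le> ennreal (max 0 (- c') + (s * max 0 a' + t * max 0 b'))"
          using c2 by (rule ennreal_leI)
        then show "e2ennreal c + (ennreal s * e2ennreal (- a) + ennreal t * e2ennreal (- b))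
            \<le> e2ennreal (- c) + (ennreal s * e2ennreal a + ennreal t * e2ennreal b)"
          unfolding ab real uminus_ereal.simps e2ennreal_ereal mult[OF s] mult[OF t] using s t by simp
      qed
    qed (use le in \<open>auto simp: ab e2ennreal_neg\<close>)
  qed
  then show "e2ennreal c \<le> ennreal s * e2ennreal a + ennreal t * e2ennreal b"
    "e2ennreal c + (ennreal s * e2ennreal (- a) + ennreal t * e2ennreal (- b))
      \<le> e2ennreal (- c) + (ennreal s * e2ennreal a + ennreal t * e2ennreal b)"
    by auto
qed

text \<open>Moving all negative parts to the other side turns the pointwise inequality into one between
  \<open>ennreal\<close>-valued functions, where integration is additive without integrability conditions.\<close>

lemma ereal_integral_le_combination:
  fixes \<phi> \<psi> \<xi> :: "'w \<Rightarrow> ereal" and s t x y :: real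
  assumes [measurable]: "\<phi> \<in> borel_measurable M" "\<psi> \<in> borel_measurable M" "\<xi> \<in> borel_measurable M"
    and s: "s > 0" and t: "t > 0"
    and le: "\<And>\<omega>. \<omega> \<in> space M \<Longrightarrow> \<xi> \<omega> \<le> ereal s * \<phi> \<omega> + ereal t * \<psi> \<omega>"
    and \<phi>: "ereal_integral M \<phi> \<le> ereal x" and \<psi>: "ereal_integral M \<psi> \<le> ereal y"
  shows "ereal_integral M \<xi> \<le> ereal (s * x + t * y)"
proof -
  define p where "p g = (\<integral>\<^sup>+ \<omega>. e2ennreal (g \<omega>) \<partial>M)" for g :: "'w \<Rightarrow> ereal"
  define n where "n g = (\<integral>\<^sup>+ \<omega>. e2ennreal (- g \<omega>) \<partial>M)" for g :: "'w \<Rightarrow> ereal"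
  have I: "ereal_integral M g = enn2ereal (p g) - enn2ereal (n g)" for g
    by (simp add: ereal_integral_def p_def n_def)
  have "p \<xi> \<le> (\<integral>\<^sup>+ \<omega>. ennreal s * e2ennreal (\<phi> \<omega>) + ennreal t * e2ennreal (\<psi> \<omega>) \<partial>M)"
    unfolding p_def by (intro nn_integral_mono e2ennreal_combination s t le)
  also have "\<dots> = ennreal s * p \<phi> + ennreal t * p \<psi>"
    unfolding p_def by (simp add: nn_integral_add nn_integral_cmult)
  finally have 1: "p \<xi> \<le> ennreal s * p \<phi> + ennreal t * p \<psi>" .
  have "(\<integral>\<^sup>+ \<omega>. e2ennreal (\<xi> \<omega>) + (ennreal s * e2ennreal (- \<phi> \<omega>) + ennreal t * e2ennreal (- \<psi> \<omega>)) \<partial>M)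
      \<le> (\<integral>\<^sup>+ \<omega>. e2ennreal (- \<xi> \<omega>) + (ennreal s * e2ennreal (\<phi> \<omega>) + ennreal t * e2ennreal (\<psi> \<omega>)) \<partial>M)"
    by (intro nn_integral_mono e2ennreal_combination s t le)
  then have 2: "p \<xi> + (ennreal s * n \<phi> + ennreal t * n \<psi>) \<le> n \<xi> + (ennreal s * p \<phi> + ennreal t * p \<psi>)"
    unfolding p_def n_def by (simp add: nn_integral_add nn_integral_cmult)
  \<comment> \<open>In \<open>ereal\<close> the difference \<infinity> - \<infinity> is \<infinity>,
    so a finite upper bound for the integral forces a finite positive part.\<close>
  have "p \<phi> \<noteq> top" "p \<psi> \<noteq> top"
    using \<phi> \<psi> unfolding I by (auto simp: ereal_minus_eq_PInfty_iff)
  then obtain a b where ab: "p \<phi> = ennreal a" "p \<psi> = ennreal b" "a \<ge> 0" "b \<ge> 0"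
    by (metis ennreal_cases)
  show ?thesis
  \<comment> \<open>If the negative part of \<open>\<xi>\<close> has infinite integral,
    \<open>1\<close> keeps the positive part finite and the integral is -\<infinity>. Otherwise
    every term of \<open>2\<close> is finite and it becomes an inequality of reals.\<close>
  proof (cases "n \<xi>")
    case (real n\<xi>)
    have fin: "n \<xi> + (ennreal s * p \<phi> + ennreal t * p \<psi>) = ennreal (n\<xi> + (s * a + t * b))"
      using s t ab real by (simp add: ennreal_mult[symmetric] ennreal_plus[symmetric] del: ennreal_plus)
    then have "ennreal s * n \<phi> + ennreal t * n \<psi> \<noteq> top" "p \<xi> \<noteq> top"
      using 2 by (auto simp: top_unique)
    then have "n \<phi> \<noteq> top" "n \<psi> \<noteq> top"
      using s t by (auto simp: ennreal_mult_top)
    then obtain c d e where cde: "n \<phi> = ennreal c" "n \<psi> = ennreal d" "p \<xi> = ennreal e" "c \<ge> 0" "d \<ge> 0" "e \<ge> 0"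
      using \<open>p \<xi> \<noteq> top\<close> by (metis ennreal_cases)
    have "p \<xi> + (ennreal s * n \<phi> + ennreal t * n \<psi>) = ennreal (e + (s * c + t * d))"
      using s t cde by (simp add: ennreal_mult[symmetric] ennreal_plus[symmetric] del: ennreal_plus)
    then have "ennreal (e + (s * c + t * d)) \<le> ennreal (n\<xi> + (s * a + t * b))"
      using 2 unfolding fin by metis
    moreover have "0 \<le> n\<xi> + (s * a + t * b)"
      using ab real s t by simp
    ultimately have "e + (s * c + t * d) \<le> n\<xi> + (s * a + t * b)"
      using ennreal_le_iff by blast
    moreover have "a - c \<le> x" "b - d \<le> y"
      using \<phi> \<psi> unfolding I by (simp_all add: ab cde)
    then have "s * (a - c) \<le> s * x" "t * (b - d) \<le> t * y"
      using s t by (auto intro: mult_left_mono)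
    ultimately have "e - n\<xi> \<le> s * x + t * y"
      by (simp add: algebra_simps)
    then show ?thesis
      unfolding I using cde real by simp
  next
    case top
    have "p \<xi> \<noteq> top"
      using 1 ab s t by (auto simp: ennreal_mult[symmetric] ennreal_plus[symmetric] top_unique simp del: ennreal_plus)
    then show ?thesis
      unfolding I using top by (cases "p \<xi>") auto
  qed
qed

text \<open>Trades a bound in \<open>ereal\<close> for one in \<open>ennreal\<close> with the values
  0 and \<infinity> included, so that estimates of logarithms become estimates of sums.\<close>

lemma log_ennreal_le_iff: "log_ennreal a \<le> ereal c \<longleftrightarrow> a \<le> ennreal (exp c)"
proof (cases a)
  case (real r)
  then show ?thesis
    using exp_le_cancel_iff[of "ln r" c] by (cases "r = 0") (auto simp: log_ennreal_def ennreal_le_iff)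
qed (auto simp: log_ennreal_def top_unique)

lemma log_ennreal_eq_MInfty: "log_ennreal a = - \<infinity> \<longleftrightarrow> a = 0"
  by (auto simp: log_ennreal_def)

lemma log_ennreal_mono:
  assumes "a \<le> b"
  shows "log_ennreal a \<le> log_ennreal b"
proof (cases "log_ennreal b")
  case (real c)
  then show ?thesis
    using assms order_trans log_ennreal_le_iff by (metis order_refl)
next
  case MInf
  then show ?thesis
    using assms by (auto simp: log_ennreal_eq_MInfty)
qed simp

lemma log_ennreal_measurable [measurable]: "log_ennreal \<in> borel_measurable borel"
  unfolding log_ennreal_def by measurable

section \<open>Partition functions and their measurability\<close>

context random_system
begin

text \<open>The set \<open>S\<close> of base points is a parameter: \<open>UNIV\<close> serves the
  two uniform pressures, a singleton the pointwise one.\<close>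

definition partition_sup ::
  "('w \<times> 'x \<Rightarrow> real) \<Rightarrow> nat \<Rightarrow> nat \<Rightarrow> real \<Rightarrow> 'x set \<Rightarrow> 'w \<Rightarrow> ennreal" where
  "partition_sup f n k \<epsilon> S \<omega> = (SUP x\<in>S. pre_partition \<theta> T f n \<omega> x \<epsilon> k)"

text \<open>Only finite sets are kept: a sum over an infinite set is 0 by convention, so an infinite
  competitor never raises the supremum.\<close>

definition fibre_separated :: "nat \<Rightarrow> nat \<Rightarrow> real \<Rightarrow> 'x set \<Rightarrow> 'w \<Rightarrow> 'x set set" where
  "fibre_separated n k \<epsilon> S \<omega> =
    {F. finite F \<and> (\<exists>x\<in>S. separated_set \<theta> T \<omega> n \<epsilon> (iter \<theta> T k \<omega> -` {x}) F)}"

lemma partition_sup_le_iff: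
  assumes "0 \<le> C"
  shows "partition_sup f n k \<epsilon> S \<omega> \<le> ennreal C \<longleftrightarrow>
    (\<forall>F\<in>fibre_separated n k \<epsilon> S \<omega>. (\<Sum>y\<in>F. exp (birkhoff_sum \<theta> T f n \<omega> y)) \<le> C)"
  unfolding partition_sup_def pre_partition_def SUP_le_iff fibre_separated_def
  using assms by (auto simp: ennreal_le_iff) (metis sum.infinite)

lemma less_partition_sup_iff:
  assumes "0 \<le> r"
  shows "ennreal r < partition_sup f n k \<epsilon> S \<omega> \<longleftrightarrow>
    (\<exists>F\<in>fibre_separated n k \<epsilon> S \<omega>. r < (\<Sum>y\<in>F. exp (birkhoff_sum \<theta> T f n \<omega> y)))"
  using partition_sup_le_iff[OF assms] by (meson not_le)

text \<open>The sum of excesses over \<epsilon> is continuous in the points and measurable in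
  \<omega>, and it is positive as soon as one excess is; it turns separation into a condition on a
  single real number.\<close>

lemma separation_iff_gap:
  assumes "n > 0"
  shows "\<epsilon> < bowen_dist \<theta> T n \<omega> x y \<longleftrightarrow>
    0 < (\<Sum>p<n. max 0 (dist (iter \<theta> T p \<omega> x) (iter \<theta> T p \<omega> y) - \<epsilon>))"
proof -
  have "\<epsilon> < bowen_dist \<theta> T n \<omega> x y \<longleftrightarrow> (\<exists>p<n. \<epsilon> < dist (iter \<theta> T p \<omega> x) (iter \<theta> T p \<omega> y))"
    unfolding bowen_dist_def using assms by (subst Max_gr_iff) auto
  also have "\<dots> \<longleftrightarrow> (\<Sum>p<n. max 0 (dist (iter \<theta> T p \<omega> x) (iter \<theta> T p \<omega> y) - \<epsilon>)) \<noteq> 0"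
    by (subst sum_nonneg_eq_0_iff) (auto simp: max_def)
  also have "\<dots> \<longleftrightarrow> 0 < (\<Sum>p<n. max 0 (dist (iter \<theta> T p \<omega> x) (iter \<theta> T p \<omega> y) - \<epsilon>))"
    by (auto simp: less_le intro!: sum_nonneg)
  finally show ?thesis .
qed

text \<open>A point \<open>z 0\<close> of \<open>S\<close> together with finitely many separated points \<open>z 1, \<dots>, z m\<close> of its fibre
  is encoded as a zero of a continuous function on the compact space of sequences.\<close>

lemma partition_sup_measurable:
  assumes f: "f \<in> L1_C P" and n: "n > 0" and \<epsilon>: "\<epsilon> > 0" and S: "closed S" "S \<noteq> {}"
  shows "partition_sup f n k \<epsilon> S \<in> borel_measurable P"
proof (rule borel_measurableI_greater)
  fix y
  show "{\<omega> \<in> space P. y < partition_sup f n k \<epsilon> S \<omega>} \<in> sets P"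
  proof (cases y)
    case top
    then show ?thesis by simp
  next
    case (real r)
    define gap where "gap \<omega> z i j = (\<Sum>p<n. max 0 (dist (iter \<theta> T p \<omega> (z (Suc i))) (iter \<theta> T p \<omega> (z (Suc j))) - \<epsilon>))"
      for \<omega> and z :: "nat \<Rightarrow> 'x" and i j
    define total where "total m \<omega> z = (\<Sum>i<m. exp (birkhoff_sum \<theta> T f n \<omega> (z (Suc i))))"
      for m \<omega> and z :: "nat \<Rightarrow> 'x"
    \<comment> \<open>Positive gaps and a total above \<open>r\<close> are strict conditions, not
      zeros of a nonnegative function. The margin \<open>1 / Suc l\<close> closes them, and the
      union over \<open>l\<close> recovers the strict ones.\<close>
    define sep where "sep m l \<omega> z = (\<Sum>i<m. \<Sum>j<m. if i = j then 0 else max 0 (1 / Suc l - gap \<omega> z i j))"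
      for m l \<omega> and z :: "nat \<Rightarrow> 'x"
    define fib where "fib m \<omega> z = (\<Sum>i<m. dist (iter \<theta> T k \<omega> (z (Suc i))) (z 0))"
      for m \<omega> and z :: "nat \<Rightarrow> 'x"
    define g where "g m l \<omega> z = infdist (z 0) S + fib m \<omega> z + sep m l \<omega> z + max 0 (r + 1 / Suc l - total m \<omega> z)"
      for m l \<omega> and z :: "nat \<Rightarrow> 'x"
    have nonneg: "0 \<le> fib m \<omega> z" "0 \<le> sep m l \<omega> z" for m l \<omega> z
      by (auto simp: fib_def sep_def intro!: sum_nonneg)
    have g_zero: "g m l \<omega> z = 0 \<longleftrightarrow> z 0 \<in> S \<and> (\<forall>i<m. iter \<theta> T k \<omega> (z (Suc i)) = z 0) \<and>
        (\<forall>i<m. \<forall>j<m. i \<noteq> j \<longrightarrow> 1 / Suc l \<le> gap \<omega> z i j) \<and> r + 1 / Suc l \<le> total m \<omega> z" for m l \<omega> z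
    proof -
      have "g m l \<omega> z = 0 \<longleftrightarrow> infdist (z 0) S = 0 \<and> fib m \<omega> z = 0 \<and> sep m l \<omega> z = 0 \<and>
          max 0 (r + 1 / Suc l - total m \<omega> z) = 0"
        unfolding g_def using nonneg(1)[of m \<omega> z] nonneg(2)[of m l \<omega> z] infdist_nonneg[of "z 0" S]
          max.cobounded1[of 0 "r + 1 / Suc l - total m \<omega> z"] by linarith
      moreover have "infdist (z 0) S = 0 \<longleftrightarrow> z 0 \<in> S"
        using in_closed_iff_infdist_zero[OF S] by blast
      moreover have "fib m \<omega> z = 0 \<longleftrightarrow> (\<forall>i<m. iter \<theta> T k \<omega> (z (Suc i)) = z 0)"
        unfolding fib_def by (subst sum_nonneg_eq_0_iff) auto
      moreover have "sep m l \<omega> z = 0 \<longleftrightarrow> (\<forall>i<m. \<forall>j<m. i \<noteq> j \<longrightarrow> 1 / Suc l \<le> gap \<omega> z i j)"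
      proof -
        have "max 0 a = 0 \<longleftrightarrow> a \<le> 0" for a :: real by (auto simp: max_def)
        then show ?thesis
          unfolding sep_def by (subst sum_nonneg_eq_0_iff) (auto intro!: sum_nonneg simp: sum_nonneg_eq_0_iff)
      qed
      ultimately show ?thesis by (auto simp: max_def)
    qed
    have "y < partition_sup f n k \<epsilon> S \<omega> \<longleftrightarrow> (\<exists>m l z. g m l \<omega> z = 0)" for \<omega>
    proof
      assume "y < partition_sup f n k \<epsilon> S \<omega>"
      then obtain F x where F: "finite F" "x \<in> S" "separated_set \<theta> T \<omega> n \<epsilon> (iter \<theta> T k \<omega> -` {x}) F"
          "r < (\<Sum>y\<in>F. exp (birkhoff_sum \<theta> T f n \<omega> y))"
        unfolding real using less_partition_sup_iff[of r] \<open>0 \<le> r\<close> by (auto simp: fibre_separated_def)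
      define m where "m = card F"
      obtain e where e: "bij_betw e {..<m} F"
        using ex_bij_betw_nat_finite[OF F(1)] by (auto simp: m_def atLeast0LessThan)
      define z where "z = case_nat x e"
      have gap_pos: "0 < gap \<omega> z i j" if "i < m" "j < m" "i \<noteq> j" for i j
      proof -
        have "e i \<in> F" "e j \<in> F" "e i \<noteq> e j"
          using e that by (auto simp: bij_betw_def inj_on_def)
        then show ?thesis
          using F(3) separation_iff_gap[OF n, of \<epsilon> \<omega> "e i" "e j"]
          by (simp add: separated_set_def gap_def z_def)
      qed
      have total: "total m \<omega> z = (\<Sum>y\<in>F. exp (birkhoff_sum \<theta> T f n \<omega> y))"
        unfolding total_def z_def using sum.reindex_bij_betw[OF e] by simp
      \<comment> \<open>The finitely many positive margins to be met at once; any
        \<open>1 / Suc l\<close> below their minimum serves.\<close>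
      define A where "A = insert (total m \<omega> z - r) ((\<lambda>(i, j). gap \<omega> z i j) ` {(i, j). i < m \<and> j < m \<and> i \<noteq> j})"
      have "finite {(i, j). i < m \<and> j < m \<and> i \<noteq> j}"
        by (rule finite_subset[of _ "{..<m} \<times> {..<m}"]) auto
      then have A: "finite A" "A \<noteq> {}" "\<And>a. a \<in> A \<Longrightarrow> 0 < a"
        using F(4) gap_pos by (auto simp: A_def total)
      then have "0 < Min A" by simp
      then obtain l where "1 / Suc l < Min A" using nat_approx_posE by blast
      then have l: "1 / Suc l \<le> a" if "a \<in> A" for a
        using Min_le[OF A(1) that] by linarith
      have "g m l \<omega> z = 0"
        unfolding g_zero
      proof (intro conjI allI impI)
        show "z 0 \<in> S" using F(2) by (simp add: z_def)
        show "iter \<theta> T k \<omega> (z (Suc i)) = z 0" if "i < m" for i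
          using F(3) e that by (auto simp: z_def separated_set_def bij_betw_def)
        show "1 / Suc l \<le> gap \<omega> z i j" if "i < m" "j < m" "i \<noteq> j" for i j
          using that by (intro l) (auto simp: A_def)
        show "r + 1 / Suc l \<le> total m \<omega> z"
          using l[of "total m \<omega> z - r"] by (simp add: A_def)
      qed
      then show "\<exists>m l z. g m l \<omega> z = 0" by blast
    next
      assume "\<exists>m l z. g m l \<omega> z = 0"
      then obtain m l z where "g m l \<omega> z = 0" by blast
      then have z: "z 0 \<in> S" "\<And>i. i < m \<Longrightarrow> iter \<theta> T k \<omega> (z (Suc i)) = z 0"
          "\<And>i j. i < m \<Longrightarrow> j < m \<Longrightarrow> i \<noteq> j \<Longrightarrow> 1 / Suc l \<le> gap \<omega> z i j" "r + 1 / Suc l \<le> total m \<omega> z"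
        unfolding g_zero by auto
      have l0: "0 < 1 / real (Suc l)" by simp
      have sep: "\<epsilon> < bowen_dist \<theta> T n \<omega> (z (Suc i)) (z (Suc j))" if "i < m" "j < m" "i \<noteq> j" for i j
      proof -
        have "0 < gap \<omega> z i j"
          using z(3)[OF that] l0 by linarith
        then show ?thesis
          unfolding separation_iff_gap[OF n] gap_def .
      qed
      define F where "F = (\<lambda>i. z (Suc i)) ` {..<m}"
      \<comment> \<open>A repeated point has gap 0 because \<open>\<epsilon> > 0\<close>, so
        distinct indices carry distinct points and the sum over indices is the sum over
        \<open>F\<close>.\<close>
      have "inj_on (\<lambda>i. z (Suc i)) {..<m}"
      proof (rule inj_onI, rule ccontr)
        fix i j assume ij: "i \<in> {..<m}" "j \<in> {..<m}" "z (Suc i) = z (Suc j)" "i \<noteq> j"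
        then have "gap \<omega> z i j = 0"
          using \<epsilon> by (simp add: gap_def)
        then show False
          using z(3)[of i j] ij l0 by simp
      qed
      then have "total m \<omega> z = (\<Sum>y\<in>F. exp (birkhoff_sum \<theta> T f n \<omega> y))"
        by (simp add: total_def F_def sum.reindex)
      then have "r < (\<Sum>y\<in>F. exp (birkhoff_sum \<theta> T f n \<omega> y))"
        using z(4) l0 by linarith
      moreover have "separated_set \<theta> T \<omega> n \<epsilon> (iter \<theta> T k \<omega> -` {z 0}) F"
        unfolding separated_set_def F_def using z(2) sep by auto
      then have "F \<in> fibre_separated n k \<epsilon> S \<omega>"
        using z(1) by (auto simp: fibre_separated_def F_def)
      ultimately show "y < partition_sup f n k \<epsilon> S \<omega>"
        unfolding real using less_partition_sup_iff[of r] \<open>0 \<le> r\<close> by blast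
    qed
    then have "{\<omega> \<in> space P. y < partition_sup f n k \<epsilon> S \<omega>} = (\<Union>m. \<Union>l. {\<omega> \<in> space P. \<exists>z. g m l \<omega> z = 0})"
      by auto
    also have "\<dots> \<in> sets P"
    proof (intro sets.countable_UN image_subsetI measurable_ex_zero compact_sequences compact_X UNIV_I)
      fix m l
      show "(\<lambda>\<omega>. g m l \<omega> z) \<in> borel_measurable P" for z
        unfolding g_def fib_def sep_def total_def gap_def
        using birkhoff_sum_measurable[OF f] iter_dist_measurable
          borel_measurable_dist_compact[OF compact_X iter_measurable measurable_const]
        by (intro borel_measurable_add borel_measurable_sum borel_measurable_max borel_measurable_diff
            borel_measurable_const measurable_If borel_measurable_exp) auto
      show "continuous_on UNIV (g m l \<omega>)" for \<omega>
      proof -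
        have ic: "continuous_on UNIV (\<lambda>z :: nat \<Rightarrow> 'x. iter \<theta> T p \<omega> (z i))" for p i
          by (rule continuous_on_compose2[OF iter_continuous]) auto
        have bc: "continuous_on UNIV (\<lambda>z :: nat \<Rightarrow> 'x. birkhoff_sum \<theta> T f n \<omega> (z i))" for i
          by (rule continuous_on_compose2[OF birkhoff_sum_continuous[OF f]]) auto
        have gc: "continuous_on UNIV (\<lambda>z. if i = j then 0 else max 0 (1 / real (Suc l) - gap \<omega> z i j))" for i j
          unfolding gap_def using ic by (cases "i = j") (auto intro!: continuous_intros)
        show ?thesis
          unfolding g_def fib_def sep_def total_def
          by (intro continuous_on_add continuous_on_sum continuous_on_max continuous_on_const
              continuous_on_diff continuous_on_exp continuous_on_infdist continuous_on_dist ic bc gc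
              continuous_on_product_coordinates)
      qed
      show "0 \<le> g m l \<omega> z" for \<omega> z
        unfolding g_def using nonneg infdist_nonneg by (intro add_nonneg_nonneg) auto
    qed
    finally show ?thesis .
  qed
qed

end

section \<open>Pressure and equilibrium measures\<close>

lemma ereal_integral_real:
  assumes "integrable M u"
  shows "ereal_integral M (\<lambda>\<omega>. ereal (u \<omega>)) = ereal (\<integral>\<omega>. u \<omega> \<partial>M)"
proof -
  have "(\<integral>\<^sup>+ \<omega>. ennreal (u \<omega>) \<partial>M) \<noteq> top" "(\<integral>\<^sup>+ \<omega>. ennreal (- u \<omega>) \<partial>M) \<noteq> top"
    using assms by (auto simp: real_integrable_def)
  then show ?thesis
    unfolding ereal_integral_def real_lebesgue_integral_def[OF assms]
    by (cases "\<integral>\<^sup>+ \<omega>. ennreal (u \<omega>) \<partial>M"; cases "\<integral>\<^sup>+ \<omega>. ennreal (- u \<omega>) \<partial>M") auto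
qed

text \<open>Replaces upper limits by eventual linear bounds, which can be added and scaled as real
  numbers. The index 0, where \<open>1 / real n\<close> is 0, is discarded by the eventual
  quantifier.\<close>

lemma limsup_average_le_iff:
  fixes a :: "nat \<Rightarrow> ereal"
  shows "limsup (\<lambda>n. ereal (1 / real n) * a n) \<le> ereal r \<longleftrightarrow>
    (\<forall>e>0. eventually (\<lambda>n. a n \<le> ereal (real n * (r + e))) sequentially)"
proof -
  have *: "ereal (1 / real n) * b \<le> ereal c \<longleftrightarrow> b \<le> ereal (real n * c)" if "n > 0" for n c and b :: ereal
    using that by (cases b) (auto simp: field_simps)
  show ?thesis
    unfolding Limsup_le_iff
  proof (intro iffI allI impI)
    fix e :: real assume H: "\<forall>y>ereal r. eventually (\<lambda>n. ereal (1 / real n) * a n < y) sequentially" and "e > 0"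
    then have "eventually (\<lambda>n. ereal (1 / real n) * a n < ereal (r + e)) sequentially"
      by simp
    then show "eventually (\<lambda>n. a n \<le> ereal (real n * (r + e))) sequentially"
      using eventually_gt_at_top[of 0] by eventually_elim (use * less_imp_le in blast)
  next
    fix y assume H: "\<forall>e>0. eventually (\<lambda>n. a n \<le> ereal (real n * (r + e))) sequentially" and "ereal r < y"
    then obtain e where e: "e > 0" "ereal (r + e) < y"
    proof (cases y)
      case (real y')
      then show ?thesis
        using that[of "(y' - r) / 2"] \<open>ereal r < y\<close> by (simp add: field_simps)
    qed (use that[of 1] in auto)
    have "eventually (\<lambda>n. a n \<le> ereal (real n * (r + e))) sequentially"
      using H e(1) by blast
    then show "eventually (\<lambda>n. ereal (1 / real n) * a n < y) sequentially"
      using eventually_gt_at_top[of 0] by eventually_elim (use * e(2) le_less_trans in blast)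
  qed
qed

text \<open>As a supremum, the limit is at most a number exactly when every scale is, so no limit in
  \<epsilon> has to be handled later.\<close>

lemma Lim_at_right_antimono:
  fixes g :: "real \<Rightarrow> ereal"
  assumes anti: "\<And>\<epsilon> \<epsilon>'. 0 < \<epsilon> \<Longrightarrow> \<epsilon> \<le> \<epsilon>' \<Longrightarrow> g \<epsilon>' \<le> g \<epsilon>"
  shows "Lim (at_right 0) g = (SUP \<epsilon>\<in>{0<..}. g \<epsilon>)"
proof (rule tendsto_Lim)
  show "(g \<longlongrightarrow> (SUP \<epsilon>\<in>{0<..}. g \<epsilon>)) (at_right 0)"
  proof (rule order_tendstoI)
    fix y assume "y < (SUP \<epsilon>\<in>{0<..}. g \<epsilon>)"
    then obtain \<epsilon>0 where \<epsilon>0: "\<epsilon>0 > 0" "y < g \<epsilon>0"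
      by (auto simp: less_SUP_iff)
    show "eventually (\<lambda>\<epsilon>. y < g \<epsilon>) (at_right 0)"
      using eventually_at_right_real[OF \<epsilon>0(1)]
    proof eventually_elim
      case (elim \<epsilon>)
      then show ?case
        using less_le_trans[OF \<epsilon>0(2) anti[of \<epsilon> \<epsilon>0]] by simp
    qed
  next
    fix y assume y: "(SUP \<epsilon>\<in>{0<..}. g \<epsilon>) < y"
    show "eventually (\<lambda>\<epsilon>. g \<epsilon> < y) (at_right 0)"
      using eventually_at_right_real[of 0 1, simplified]
      by eventually_elim (use y in \<open>auto intro: le_less_trans[OF SUP_upper]\<close>)
  qed
qed simp

lemma pre_partition_antimono:
  assumes "\<epsilon> \<le> \<epsilon>'"
  shows "pre_partition \<theta> T f n \<omega> x \<epsilon>' k \<le> pre_partition \<theta> T f n \<omega> x \<epsilon> k"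
  unfolding pre_partition_def
  by (rule SUP_subset_mono) (use assms in \<open>force simp: separated_set_def\<close>)+

context random_system
begin

text \<open>Hoelder's inequality for each separated set, proved from the convexity of
  \<open>exp\<close>.\<close>

lemma log_partition_convex:
  assumes s: "s > 0" and t: "t > 0" and st: "s + t = 1"
  shows "log_ennreal (partition_sup (\<lambda>z. s * f z + t * g z) n k \<epsilon> S \<omega>)
    \<le> ereal s * log_ennreal (partition_sup f n k \<epsilon> S \<omega>) + ereal t * log_ennreal (partition_sup g n k \<epsilon> S \<omega>)"
proof -
  let ?h = "\<lambda>z. s * f z + t * g z"
  let ?Z = "\<lambda>f. partition_sup f n k \<epsilon> S \<omega>"
  let ?a = "log_ennreal (?Z f)" and ?b = "log_ennreal (?Z g)"
  let ?E = "fibre_separated n k \<epsilon> S \<omega>"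
  let ?S = "\<lambda>f. birkhoff_sum \<theta> T f n \<omega>"
  \<comment> \<open>Vanishing depends on the fibres only, not on the potential. Hence both
    logarithms are -\<infinity> or neither is, and the sum never mixes \<infinity> with
    -\<infinity>.\<close>
  have zero: "?Z f = 0 \<longleftrightarrow> (\<forall>F\<in>?E. F = {})" for f
  proof -
    have "(\<Sum>y\<in>F. exp (?S f y)) \<le> 0 \<longleftrightarrow> F = {}" if "F \<in> ?E" for F
    proof -
      have "finite F" using that by (simp add: fibre_separated_def)
      then have "F \<noteq> {} \<Longrightarrow> 0 < (\<Sum>y\<in>F. exp (?S f y))"
        by (intro sum_pos) auto
      then show ?thesis by fastforce
    qed
    then show ?thesis
      using partition_sup_le_iff[of 0 f n k \<epsilon> S \<omega>] by simp
  qed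
  consider "?Z f = 0" | "?a \<noteq> - \<infinity>" "?b \<noteq> - \<infinity>" "?a = \<infinity> \<or> ?b = \<infinity>" | "\<bar>?a\<bar> \<noteq> \<infinity>" "\<bar>?b\<bar> \<noteq> \<infinity>"
    using zero[of f] zero[of g] log_ennreal_eq_MInfty by auto
  then show ?thesis
  proof cases
    case 1
    then have "?Z ?h = 0"
      using zero by simp
    then show ?thesis
      by (simp add: log_ennreal_def)
  next
    case 2
    then have top: "ereal s * ?a + ereal t * ?b = \<infinity>"
      using s t by (cases rule: ereal2_cases[of ?a ?b]) auto
    show ?thesis unfolding top by simp
  next
    case 3
    then obtain a b where ab: "?a = ereal a" "?b = ereal b"
      by (cases ?a; cases ?b) auto
    have Z_le: "?Z f \<le> ennreal (exp a)" "?Z g \<le> ennreal (exp b)"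
      using log_ennreal_le_iff[of "?Z f" a] log_ennreal_le_iff[of "?Z g" b] unfolding ab by auto
    have le: "(\<Sum>y\<in>F. exp (?S f y)) \<le> exp a" "(\<Sum>y\<in>F. exp (?S g y)) \<le> exp b" if "F \<in> ?E" for F
      using that Z_le[unfolded partition_sup_le_iff[OF exp_ge_zero]] by auto
    have "(\<Sum>y\<in>F. exp (?S ?h y)) \<le> exp (s * a + t * b)" if F: "F \<in> ?E" for F
    proof -
      \<comment> \<open>The weighted arithmetic-geometric inequality after normalising by
        \<open>exp a\<close> and \<open>exp b\<close>; each normalised sum over \<open>F\<close> is
        at most 1.\<close>
      have pt: "exp (?S ?h y) \<le> exp (s * a + t * b) * (s * (exp (?S f y) / exp a) + t * (exp (?S g y) / exp b))" for y
      proof -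
        have "exp (?S ?h y) = exp (s * a + t * b) * exp (s * (?S f y - a) + t * (?S g y - b))"
          by (simp add: birkhoff_sum_linear exp_add[symmetric] algebra_simps)
        also have "exp (s * (?S f y - a) + t * (?S g y - b)) \<le> s * exp (?S f y - a) + t * exp (?S g y - b)"
        proof -
          have "s = 1 - t" using st by simp
          then show ?thesis
            using convex_onD[OF exp_convex, of t "?S f y - a" "?S g y - b"] s t by simp
        qed
        finally show ?thesis
          by (simp add: exp_diff)
      qed
      have "(\<Sum>y\<in>F. exp (?S ?h y)) \<le> (\<Sum>y\<in>F. exp (s * a + t * b) * (s * (exp (?S f y) / exp a) + t * (exp (?S g y) / exp b)))"
        by (intro sum_mono pt)
      also have "\<dots> = exp (s * a + t * b) * (s * ((\<Sum>y\<in>F. exp (?S f y)) / exp a) + t * ((\<Sum>y\<in>F. exp (?S g y)) / exp b))"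
        by (simp add: sum_distrib_left sum.distrib sum_divide_distrib algebra_simps)
      also have "\<dots> \<le> exp (s * a + t * b) * (s * 1 + t * 1)"
        using le[OF F] s t by (intro mult_left_mono add_mono) auto
      finally show ?thesis using st by simp
    qed
    then have "log_ennreal (?Z ?h) \<le> ereal (s * a + t * b)"
      by (subst log_ennreal_le_iff, subst partition_sup_le_iff) auto
    then show ?thesis
      by (simp add: ab)
  qed
qed

text \<open>The factors \<open>ereal 1\<close> give the bound the shape that
  \<open>ereal_integral_le_combination\<close> takes as input.\<close>

lemma log_partition_le_add:
  assumes le: "\<And>x. birkhoff_sum \<theta> T f n \<omega> x \<le> birkhoff_sum \<theta> T g n \<omega> x + u"
  shows "log_ennreal (partition_sup f n k \<epsilon> S \<omega>)
    \<le> ereal 1 * log_ennreal (partition_sup g n k \<epsilon> S \<omega>) + ereal 1 * ereal u"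
    (is "log_ennreal ?Zf \<le> ereal 1 * ?b + _")
proof -
  let ?E = "fibre_separated n k \<epsilon> S \<omega>"
  have scale: "?Zf \<le> ennreal (exp u * C)" if C: "0 \<le> C" "partition_sup g n k \<epsilon> S \<omega> \<le> ennreal C" for C
  proof -
    have "(\<Sum>y\<in>F. exp (birkhoff_sum \<theta> T f n \<omega> y)) \<le> exp u * C" if "F \<in> ?E" for F
    proof -
      have "(\<Sum>y\<in>F. exp (birkhoff_sum \<theta> T f n \<omega> y)) \<le> (\<Sum>y\<in>F. exp u * exp (birkhoff_sum \<theta> T g n \<omega> y))"
        using le by (intro sum_mono) (simp add: exp_add[symmetric] add.commute)
      also have "\<dots> = exp u * (\<Sum>y\<in>F. exp (birkhoff_sum \<theta> T g n \<omega> y))"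
        by (simp add: sum_distrib_left)
      also have "\<dots> \<le> exp u * C"
        using that C(2) unfolding partition_sup_le_iff[OF C(1)] by (intro mult_left_mono) auto
      finally show ?thesis .
    qed
    then show ?thesis
      using C(1) by (subst partition_sup_le_iff) auto
  qed
  show ?thesis
  proof (cases ?b)
    case (real b)
    then have "?Zf \<le> ennreal (exp u * exp b)"
      using log_ennreal_le_iff[of "partition_sup g n k \<epsilon> S \<omega>" b] by (intro scale) auto
    then show ?thesis
      using log_ennreal_le_iff[of ?Zf "b + u"] real by (simp add: exp_add mult.commute)
  next
    case MInf
    then have "partition_sup g n k \<epsilon> S \<omega> = 0"
      by (simp add: log_ennreal_eq_MInfty)
    then have "?Zf = 0"
      using scale[of 0] by simp
    then show ?thesis
      by (simp add: log_ennreal_def)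
  qed simp
qed

section \<open>Growth rates and their comparison\<close>

definition log_growth :: "('w \<times> 'x \<Rightarrow> real) \<Rightarrow> nat \<Rightarrow> nat \<Rightarrow> real \<Rightarrow> 'x set \<Rightarrow> ereal" where
  "log_growth f n k \<epsilon> S = ereal_integral P (\<lambda>\<omega>. log_ennreal (partition_sup f n k \<epsilon> S \<omega>))"

lemma log_growth_convex:
  assumes "f \<in> L1_C P" "g \<in> L1_C P" "n > 0" "\<epsilon> > 0" "closed S" "S \<noteq> {}"
    and "s > 0" "t > 0" "s + t = 1"
    and "log_growth f n k \<epsilon> S \<le> ereal x" "log_growth g n k \<epsilon> S \<le> ereal y"
  shows "log_growth (\<lambda>z. s * f z + t * g z) n k \<epsilon> S \<le> ereal (s * x + t * y)"
proof -
  have [measurable]: "partition_sup h n k \<epsilon> S \<in> borel_measurable P" if "h \<in> L1_C P" for h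
    using assms that by (intro partition_sup_measurable)
  have h: "(\<lambda>z. s * f z + t * g z) \<in> L1_C P"
    using assms by (intro L1.V_add L1.V_scale)
  show ?thesis
    using assms h unfolding log_growth_def
    by (intro ereal_integral_le_combination[OF _ _ _ assms(7,8) log_partition_convex[OF assms(7-9)]]) auto
qed

lemma log_growth_le_add:
  assumes "f \<in> L1_C P" "g \<in> L1_C P" "n > 0" "\<epsilon> > 0" "closed S" "S \<noteq> {}"
    and u: "integrable P u"
    and le: "\<And>\<omega> x. birkhoff_sum \<theta> T f n \<omega> x \<le> birkhoff_sum \<theta> T g n \<omega> x + u \<omega>"
    and y: "log_growth g n k \<epsilon> S \<le> ereal y"
  shows "log_growth f n k \<epsilon> S \<le> ereal (y + (\<integral>\<omega>. u \<omega> \<partial>P))"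
proof -
  have [measurable]: "partition_sup h n k \<epsilon> S \<in> borel_measurable P" if "h \<in> L1_C P" for h
    using assms that by (intro partition_sup_measurable)
  have [measurable]: "u \<in> borel_measurable P"
    using u by auto
  have "log_growth f n k \<epsilon> S \<le> ereal (1 * y + 1 * (\<integral>\<omega>. u \<omega> \<partial>P))"
    unfolding log_growth_def
  proof (rule ereal_integral_le_combination)
    show "log_ennreal (partition_sup f n k \<epsilon> S \<omega>) \<le> ereal 1 * log_ennreal (partition_sup g n k \<epsilon> S \<omega>) + ereal 1 * ereal (u \<omega>)"
      for \<omega> using le by (rule log_partition_le_add)
  qed (use assms ereal_integral_real[OF u] in \<open>auto simp: log_growth_def\<close>)
  then show ?thesis by simp
qed

text \<open>All three pressures have the form of a supremum, over pairs of a scale \<open>\<epsilon>\<close> and a set \<open>S\<close> of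
  admissible base points, of upper growth rates along the fibre depths \<open>k \<in> K n\<close>. Upper bounds by
  real numbers determine them and avoid arithmetic with infinities.\<close>

definition growth_le ::
  "(real \<times> 'x set) set \<Rightarrow> (nat \<Rightarrow> nat set) \<Rightarrow> ('w \<times> 'x \<Rightarrow> real) \<Rightarrow> real \<Rightarrow> bool" where
  "growth_le A K f r \<longleftrightarrow> (\<forall>(\<epsilon>, S)\<in>A. \<forall>e>0. eventually
     (\<lambda>n. \<forall>k\<in>K n. log_growth f n k \<epsilon> S \<le> ereal (real n * (r + e))) sequentially)"

text \<open>Together with \<open>n > 0\<close>, the conditions under which
  \<open>partition_sup\<close> is known to be measurable.\<close>

definition admissible :: "(real \<times> 'x set) set \<Rightarrow> bool" where
  "admissible A \<longleftrightarrow> (\<forall>(\<epsilon>, S)\<in>A. \<epsilon> > 0 \<and> closed S \<and> S \<noteq> {})"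

lemma growth_le_convex:
  assumes A: "admissible A" and f: "f \<in> L1_C P" and g: "g \<in> L1_C P" and st: "s > 0" "t > 0" "s + t = 1"
    and x: "growth_le A K f x" and y: "growth_le A K g y"
  shows "growth_le A K (\<lambda>z. s * f z + t * g z) (s * x + t * y)"
  unfolding growth_le_def
proof (safe)
  fix \<epsilon> S and e :: real assume a: "(\<epsilon>, S) \<in> A" and e: "e > 0"
  have adm: "\<epsilon> > 0" "closed S" "S \<noteq> {}"
    using A a by (auto simp: admissible_def)
  have "eventually (\<lambda>n. \<forall>k\<in>K n. log_growth f n k \<epsilon> S \<le> ereal (real n * (x + e))) sequentially"
    "eventually (\<lambda>n. \<forall>k\<in>K n. log_growth g n k \<epsilon> S \<le> ereal (real n * (y + e))) sequentially"
    using x y a e by (auto simp: growth_le_def)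
  then show "eventually (\<lambda>n. \<forall>k\<in>K n. log_growth (\<lambda>z. s * f z + t * g z) n k \<epsilon> S
      \<le> ereal (real n * (s * x + t * y + e))) sequentially"
    using eventually_gt_at_top[of 0]
  proof eventually_elim
    case (elim n)
    have eq: "s * (real n * (x + e)) + t * (real n * (y + e)) = real n * (s * x + t * y + e)"
    proof -
      have "s * (real n * (x + e)) + t * (real n * (y + e)) = real n * (s * x + t * y + (s + t) * e)"
        by (simp add: algebra_simps)
      then show ?thesis using st by simp
    qed
    show ?case
    proof
      fix k assume "k \<in> K n"
      then show "log_growth (\<lambda>z. s * f z + t * g z) n k \<epsilon> S \<le> ereal (real n * (s * x + t * y + e))"
        using elim log_growth_convex[OF f g _ adm st, of n k "real n * (x + e)" "real n * (y + e)"]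
        unfolding eq by blast
    qed
  qed
qed

text \<open>The rate \<open>c\<close> shifts the pressure bound, while the constant \<open>d\<close>
  is lost on division by \<open>n\<close>; such a bounded error is what coboundaries
  produce.\<close>

lemma growth_le_compare:
  assumes A: "admissible A" and f: "f \<in> L1_C P" and g: "g \<in> L1_C P"
    and u: "\<And>n. integrable P (u n)" "\<And>n. (\<integral>\<omega>. u n \<omega> \<partial>P) \<le> real n * c + d"
    and le: "\<And>n \<omega> x. birkhoff_sum \<theta> T f n \<omega> x \<le> birkhoff_sum \<theta> T g n \<omega> x + u n \<omega>"
    and r: "growth_le A K g r"
  shows "growth_le A K f (r + c)"
  unfolding growth_le_def
proof (safe)
  fix \<epsilon> S and e :: real assume a: "(\<epsilon>, S) \<in> A" and e: "e > 0"
  have adm: "\<epsilon> > 0" "closed S" "S \<noteq> {}"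
    using A a by (auto simp: admissible_def)
  have ev: "eventually (\<lambda>n. \<forall>k\<in>K n. log_growth g n k \<epsilon> S \<le> ereal (real n * (r + e / 2))) sequentially"
    using r a e by (auto simp: growth_le_def)
  \<comment> \<open>From \<open>N\<close> on, half of the tolerance, \<open>n e / 2\<close>, absorbs
    \<open>d\<close>.\<close>
  obtain N where N: "d / (e / 2) \<le> real N"
    using real_arch_simple by blast
  show "eventually (\<lambda>n. \<forall>k\<in>K n. log_growth f n k \<epsilon> S \<le> ereal (real n * (r + c + e))) sequentially"
    using ev eventually_gt_at_top[of 0] eventually_ge_at_top[of N]
  proof eventually_elim
    case (elim n)
    have "d / (e / 2) \<le> real n"
      using N elim(3) by linarith
    then have "d \<le> real n * (e / 2)"
      using e by (simp add: field_simps)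
    then have le': "real n * (r + e / 2) + (\<integral>\<omega>. u n \<omega> \<partial>P) \<le> real n * (r + c + e)"
      using u(2)[of n] by (simp add: algebra_simps)
    show ?case
    proof
      fix k assume "k \<in> K n"
      then have "log_growth f n k \<epsilon> S \<le> ereal (real n * (r + e / 2) + (\<integral>\<omega>. u n \<omega> \<partial>P))"
        using elim by (intro log_growth_le_add[OF f g _ adm u(1) le]) auto
      also have "\<dots> \<le> ereal (real n * (r + c + e))"
        using le' by simp
      finally show "log_growth f n k \<epsilon> S \<le> ereal (real n * (r + c + e))" .
    qed
  qed
qed

lemma growth_le_fst:
  assumes "admissible A" "integrable P c" "growth_le A K (\<lambda>_. 0) r"
  shows "growth_le A K (\<lambda>z. c (fst z)) (r + (\<integral>\<omega>. c \<omega> \<partial>P))"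
proof (rule growth_le_compare[OF assms(1) L1_C_fst[OF assms(2)] L1.V_const _ _ _ assms(3)])
  let ?u = "\<lambda>n \<omega>. \<Sum>j = 0..<n. c ((\<theta> ^^ j) \<omega>)"
  show "integrable P (?u n)" for n
    by (intro Bochner_Integration.integrable_sum integral_shift_power assms)
  show "(\<integral>\<omega>. ?u n \<omega> \<partial>P) \<le> real n * (\<integral>\<omega>. c \<omega> \<partial>P) + 0" for n
    by (subst Bochner_Integration.integral_sum) (simp_all add: integral_shift_power assms)
qed (simp add: birkhoff_sum_def)

text \<open>Compared with the zero potential it bounds the pressure of \<open>f\<close> from above;
  with the roles exchanged it excludes the value -\<infinity>.\<close>

lemma growth_le_norm:
  assumes "admissible A" and f: "f \<in> L1_C P" and g: "g \<in> L1_C P" and "growth_le A K g r"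
  shows "growth_le A K f (r + (\<integral>\<omega>. sup_abs (\<lambda>z. f z - g z) \<omega> \<partial>P))"
proof (rule growth_le_compare[OF assms(1) f g _ _ _ assms(4)])
  have fg: "(\<lambda>z. f z - g z) \<in> L1_C P"
    using f g by (rule L1.V_diff)
  let ?u = "\<lambda>n \<omega>. \<Sum>j = 0..<n. sup_abs (\<lambda>z. f z - g z) ((\<theta> ^^ j) \<omega>)"
  show "integrable P (?u n)" for n
    by (intro Bochner_Integration.integrable_sum integral_shift_power integrable_sup_abs fg)
  show "(\<integral>\<omega>. ?u n \<omega> \<partial>P) \<le> real n * (\<integral>\<omega>. sup_abs (\<lambda>z. f z - g z) \<omega> \<partial>P) + 0" for n
    by (subst Bochner_Integration.integral_sum) (simp_all add: integral_shift_power integrable_sup_abs fg)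
  show "birkhoff_sum \<theta> T f n \<omega> x \<le> birkhoff_sum \<theta> T g n \<omega> x + ?u n \<omega>" for n \<omega> x
    unfolding birkhoff_sum_def sum.distrib[symmetric]
  proof (intro sum_mono)
    fix j
    show "f ((\<theta> ^^ j) \<omega>, iter \<theta> T j \<omega> x) \<le> g ((\<theta> ^^ j) \<omega>, iter \<theta> T j \<omega> x) + sup_abs (\<lambda>z. f z - g z) ((\<theta> ^^ j) \<omega>)"
      using abs_le_sup_abs[OF fg, of "(\<theta> ^^ j) \<omega>" "iter \<theta> T j \<omega> x"] by simp
  qed
qed

text \<open>The Birkhoff sums of a coboundary telescope, so their integrals stay bounded.\<close>

lemma growth_le_coboundary:
  assumes "admissible A" and g: "g \<in> L1_C P" and "growth_le A K (\<lambda>_. 0) r"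
  shows "growth_le A K (\<lambda>z. c * (g (skew_product \<theta> T z) - g z)) r"
proof -
  have f: "(\<lambda>z. c * (g (skew_product \<theta> T z) - g z)) \<in> L1_C P"
    by (intro L1.V_scale L1.V_diff L1_C_skew_product g)
  let ?u = "\<lambda>n \<omega>. \<bar>c\<bar> * (sup_abs g ((\<theta> ^^ n) \<omega>) + sup_abs g \<omega>)"
  have "growth_le A K (\<lambda>z. c * (g (skew_product \<theta> T z) - g z)) (r + 0)"
  proof (rule growth_le_compare[OF assms(1) f L1.V_const _ _ _ assms(3)])
    note int = integral_shift_power[OF integrable_sup_abs[OF g]] integrable_sup_abs[OF g]
    show "integrable P (?u n)" for n
      by (intro integrable_mult_right Bochner_Integration.integrable_add int)
    show "(\<integral>\<omega>. ?u n \<omega> \<partial>P) \<le> real n * 0 + 2 * \<bar>c\<bar> * (\<integral>\<omega>. sup_abs g \<omega> \<partial>P)" for n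
      using int by simp
    show "birkhoff_sum \<theta> T (\<lambda>z. c * (g (skew_product \<theta> T z) - g z)) n \<omega> x
        \<le> birkhoff_sum \<theta> T (\<lambda>_. 0) n \<omega> x + ?u n \<omega>" for n \<omega> x
    proof -
      have "birkhoff_sum \<theta> T (\<lambda>z. c * (g (skew_product \<theta> T z) - g z)) n \<omega> x
          = c * (g ((\<theta> ^^ n) \<omega>, iter \<theta> T n \<omega> x) - g (\<omega>, x))"
        by (induction n) (simp_all add: birkhoff_sum_def skew_product_def algebra_simps)
      also have "\<dots> \<le> \<bar>c\<bar> * \<bar>g ((\<theta> ^^ n) \<omega>, iter \<theta> T n \<omega> x) - g (\<omega>, x)\<bar>"
        by (simp add: abs_mult[symmetric])
      also have "\<dots> \<le> ?u n \<omega>"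
        using abs_le_sup_abs[OF g, of "(\<theta> ^^ n) \<omega>" "iter \<theta> T n \<omega> x"] abs_le_sup_abs[OF g, of \<omega> x]
        by (intro mult_left_mono) linarith+
      finally show ?thesis
        by (simp add: birkhoff_sum_def)
    qed
  qed
  then show ?thesis by simp
qed

text \<open>\<open>pr\<close> enters only through its real upper bounds, so one argument covers all
  three pressures. The conclusion is the subgradient inequality at 0, rearranged.\<close>

lemma equilibrium_measure:
  assumes A: "admissible A"
    and pr: "\<And>f r. pr f \<le> ereal r \<longleftrightarrow> growth_le A K f r"
    and zero: "pr (\<lambda>_. 0) = ereal p0"
  shows "\<exists>\<mu>\<in>invariant_measures P \<theta> T. \<forall>f\<in>L1_C P. pr (\<lambda>_. 0) \<le> pr f - ereal (\<integral>z. f z \<partial>\<mu>)"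
proof -
  have V0: "(\<lambda>_ :: 'w \<times> 'x. 0) \<in> L1_C P"
    by (rule L1.V_const)
  have p0: "growth_le A K (\<lambda>_. 0) r \<longleftrightarrow> p0 \<le> r" for r
    using pr[of "\<lambda>_. 0" r] zero by simp
  have finite: "\<bar>pr f\<bar> \<noteq> \<infinity>" if f: "f \<in> L1_C P" for f
  proof -
    have "pr f \<le> ereal (p0 + (\<integral>\<omega>. sup_abs (\<lambda>z. f z - 0) \<omega> \<partial>P))"
      unfolding pr using p0 by (intro growth_le_norm[OF A f V0]) auto
    moreover have "pr f \<noteq> - \<infinity>"
    proof
      assume "pr f = - \<infinity>"
      then have "growth_le A K f r" for r
        unfolding pr[symmetric] by simp
      \<comment> \<open>The bound for \<open>f\<close> is taken so low that the zero potential would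
        get the bound \<open>p0 - 1\<close>.\<close>
      from growth_le_norm[OF A V0 f this[of "p0 - (\<integral>\<omega>. sup_abs (\<lambda>z. 0 - f z) \<omega> \<partial>P) - 1"]]
      show False
        unfolding p0 by simp
    qed
    ultimately show ?thesis by auto
  qed
  define q where "q f = real_of_ereal (pr f) - p0" for f
  have pr_q: "pr f = ereal (q f + p0)" if "f \<in> L1_C P" for f
    using finite[OF that] by (simp add: q_def ereal_real)
  have q_le: "q f \<le> r \<longleftrightarrow> growth_le A K f (r + p0)" if "f \<in> L1_C P" for f r
    using pr[of f "r + p0"] pr_q[OF that] by simp
  have "\<exists>L. L1.linear_functional L \<and> (\<forall>f\<in>L1_C P. L f \<le> q f)"
  proof (rule L1.convex_dominates_linear)
    show "q (\<lambda>_. 0) = 0"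
      using zero by (simp add: q_def)
    fix f g :: "'w \<times> 'x \<Rightarrow> real" and s t :: real
    assume f: "f \<in> L1_C P" and g: "g \<in> L1_C P" and st: "s > 0" "t > 0" "s + t = 1"
    have "growth_le A K (\<lambda>z. s * f z + t * g z) (s * (q f + p0) + t * (q g + p0))"
      using q_le[OF f, of "q f"] q_le[OF g, of "q g"] by (intro growth_le_convex[OF A f g st]) auto
    moreover have "s * (q f + p0) + t * (q g + p0) = s * q f + t * q g + (s + t) * p0"
      by (simp add: algebra_simps)
    ultimately show "q (\<lambda>x. s * f x + t * g x) \<le> s * q f + t * q g"
      using f g st by (subst q_le) (auto intro!: L1.V_add L1.V_scale)
  qed
  then obtain L where L: "L1.linear_functional L" and L_le: "\<And>f. f \<in> L1_C P \<Longrightarrow> L f \<le> q f"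
    by blast
  have L_add: "L (\<lambda>z. f z + g z) = L f + L g" if "f \<in> L1_C P" "g \<in> L1_C P" for f g
    using L that by (simp add: L1.linear_functional_def)
  have L_scale: "L (\<lambda>z. c * f z) = c * L f" if "f \<in> L1_C P" for f c
    using L that by (simp add: L1.linear_functional_def)
  have L_fst_le: "L (\<lambda>z. c (fst z)) \<le> (\<integral>\<omega>. c \<omega> \<partial>P)" if c: "integrable P c" for c
  proof -
    have "q (\<lambda>z. c (fst z)) \<le> (\<integral>\<omega>. c \<omega> \<partial>P)"
      unfolding q_le[OF L1_C_fst[OF c]]
      using growth_le_fst[OF A c, of K p0] p0 by (simp add: add.commute)
    then show ?thesis
      using L_le[OF L1_C_fst[OF c]] by simp
  qed
  have L_fst: "L (\<lambda>z. c (fst z)) = (\<integral>\<omega>. c \<omega> \<partial>P)" if c: "integrable P c" for c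
    using L_fst_le[OF c] L_fst_le[of "\<lambda>\<omega>. - c \<omega>"] L_scale[OF L1_C_fst[OF c], of "-1"] c by simp
  have L_nonneg: "0 \<le> L f" if f: "f \<in> L1_C P" and f0: "\<And>z. 0 \<le> f z" for f
  proof -
    have nf: "(\<lambda>z. - f z) \<in> L1_C P"
      using f by (rule L1.V_uminus)
    have "growth_le A K (\<lambda>z. - f z) (p0 + 0)"
    proof (rule growth_le_compare[OF A nf V0, where u = "\<lambda>_ _. 0" and d = 0])
      show "birkhoff_sum \<theta> T (\<lambda>z. - f z) n \<omega> x \<le> birkhoff_sum \<theta> T (\<lambda>_. 0) n \<omega> x + 0" for n \<omega> x
        unfolding birkhoff_sum_def using f0 by (simp add: sum_negf sum_nonneg)
    qed (use p0 in auto)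
    then have "q (\<lambda>z. - f z) \<le> 0"
      using q_le[OF nf, of 0] by simp
    then show ?thesis
      using L_le[OF nf] L_scale[OF f, of "-1"] by simp
  qed
  interpret L: daniell "L1_C P" "P \<Otimes>\<^sub>M borel :: ('w \<times> 'x) measure" L
  proof
    show "L1.linear_functional L" by fact
    show "0 \<le> L f" if "f \<in> L1_C P" "\<And>z. 0 \<le> f z" for f
      using that by (rule L_nonneg)
    fix F :: "nat \<Rightarrow> 'w \<times> 'x \<Rightarrow> real"
    assume F: "\<And>n. F n \<in> L1_C P" and dec: "\<And>z. decseq (\<lambda>n. F n z)" and lim: "\<And>z. (\<lambda>n. F n z) \<longlonglongrightarrow> 0"
    have nonneg: "0 \<le> F n z" for n z
      using decseq_ge[OF dec lim] .
    \<comment> \<open>Positivity compares \<open>F n\<close> with the function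
      \<open>sup_abs (F n)\<close> of \<omega> alone, on which \<open>L\<close> is integration
      against \<open>P\<close>.\<close>
    have le: "L (F n) \<le> (\<integral>\<omega>. sup_abs (F n) \<omega> \<partial>P)" for n
    proof -
      have sup: "(\<lambda>z :: 'w \<times> 'x. sup_abs (F n) (fst z)) \<in> L1_C P"
        by (rule L1_C_fst[OF integrable_sup_abs[OF F]])
      have "0 \<le> L (\<lambda>z. sup_abs (F n) (fst z) + (-1) * F n z)"
      proof (rule L_nonneg)
        show "0 \<le> sup_abs (F n) (fst z) + (-1) * F n z" for z
          using abs_le_sup_abs[OF F, of n "fst z" "snd z"] by simp
      qed (intro L1.V_add L1.V_scale sup F)
      then show ?thesis
        using L_add[OF sup L1.V_scale[OF F, of "-1" n]] L_scale[OF F, of "-1" n]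
          L_fst[OF integrable_sup_abs[OF F]] by simp
    qed
    show "(\<lambda>n. L (F n)) \<longlonglongrightarrow> 0"
      by (rule tendsto_sandwich[OF _ _ tendsto_const sup_abs_tendsto_zero[OF F dec lim]])
        (use le L_nonneg[OF F nonneg] in auto)
  qed
  define \<mu> where "\<mu> = L.representing_measure"
  have sets_\<mu> [simp, measurable_cong]: "sets \<mu> = sets (P \<Otimes>\<^sub>M borel)"
    by (simp add: \<mu>_def)
  have space_\<mu>: "space \<mu> = UNIV"
    using sets_eq_imp_space_eq[OF sets_\<mu>] L1.space_V by simp
  have int: "integrable \<mu> f" "(\<integral>z. f z \<partial>\<mu>) = L f" if "f \<in> L1_C P" for f
    using L.daniell_stone[OF that] by (simp_all add: \<mu>_def)
  interpret \<mu>: prob_space \<mu>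
  proof
    have "L (\<lambda>_. 1) = 1"
      using L_fst[of "\<lambda>_. 1"] by (simp add: prob_space)
    then show "emeasure \<mu> (space \<mu>) = 1"
      using L.emeasure_representing_UNIV unfolding space_\<mu> by (simp add: \<mu>_def)
  qed
  have fst_m: "fst \<in> measurable \<mu> P"
    by measurable
  have "distr \<mu> P fst = P"
  proof (rule measure_eqI)
    fix B assume "B \<in> sets (distr \<mu> P fst)"
    then have B: "B \<in> sets P" by simp
    have ind: "integrable P (indicator B :: 'w \<Rightarrow> real)"
      using B by (intro integrable_real_indicator) (auto simp: emeasure_eq_measure)
    have "measure \<mu> (fst -` B) = (\<integral>z. indicator (fst -` B) z \<partial>\<mu>)"
      using measurable_sets[OF fst_m B] by (simp add: space_\<mu>)
    also have "\<dots> = (\<integral>z. indicator B (fst z) \<partial>\<mu>)"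
      by (intro Bochner_Integration.integral_cong) (auto simp: indicator_def)
    also have "\<dots> = measure P B"
      using int(2)[OF L1_C_fst[OF ind]] L_fst[OF ind] B by simp
    finally show "emeasure (distr \<mu> P fst) B = emeasure P B"
      using B by (simp add: emeasure_distr[OF fst_m] space_\<mu> \<mu>.emeasure_eq_measure emeasure_eq_measure)
  qed simp
  then have "\<mu> \<in> marginal_measures P"
    by (simp add: marginal_measures_def \<mu>.prob_space_axioms)
  moreover have "distr \<mu> \<mu> (skew_product \<theta> T) = \<mu>"
  proof (rule L1.measure_eq_if_integrals_eq)
    have \<Theta>: "skew_product \<theta> T \<in> measurable \<mu> \<mu>"
      using skew_product_measurable by (simp cong: measurable_cong_sets)
    show "finite_measure (distr \<mu> \<mu> (skew_product \<theta> T))"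
      by (rule \<mu>.finite_measure_distr[OF \<Theta>])
    show "finite_measure \<mu>"
      by (rule \<mu>.finite_measure_axioms)
    fix g :: "'w \<times> 'x \<Rightarrow> real" assume g: "g \<in> L1_C P"
    note g\<Theta> = L1_C_skew_product[OF g]
    define D where "D = L (\<lambda>z. g (skew_product \<theta> T z) + (-1) * g z)"
    have DV: "(\<lambda>z. g (skew_product \<theta> T z) + (-1) * g z) \<in> L1_C P"
      by (intro L1.V_add L1.V_scale g\<Theta> g)
    \<comment> \<open>Every real multiple of a coboundary obeys the same bound; opposite signs of
      \<open>c\<close> then force \<open>D = 0\<close>.\<close>
    have "c * D \<le> 0" for c
    proof -
      have "growth_le A K (\<lambda>z. c * (g (skew_product \<theta> T z) - g z)) p0"
        using p0 by (intro growth_le_coboundary[OF A g]) simp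
      then have "q (\<lambda>z. c * (g (skew_product \<theta> T z) + (-1) * g z)) \<le> 0"
        using q_le[OF L1.V_scale[OF DV], of c 0] by simp
      then show ?thesis
        using L_le[OF L1.V_scale[OF DV], of c] L_scale[OF DV, of c] by (simp add: D_def)
    qed
    from this[of 1] this[of "-1"] have "D = 0" by simp
    then have "L (\<lambda>z. g (skew_product \<theta> T z)) = L g"
      unfolding D_def L_add[OF g\<Theta> L1.V_scale[OF g]] L_scale[OF g] by simp
    moreover have "(\<integral>z. g z \<partial>distr \<mu> \<mu> (skew_product \<theta> T)) = (\<integral>z. g (skew_product \<theta> T z) \<partial>\<mu>)"
      using L1_C_measurable[OF g] by (intro integral_distr[OF \<Theta>]) simp
    ultimately show "(\<integral>z. g z \<partial>distr \<mu> \<mu> (skew_product \<theta> T)) = (\<integral>z. g z \<partial>\<mu>)"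
      using int(2)[OF g] int(2)[OF g\<Theta>] by simp
  qed simp_all
  ultimately have "\<mu> \<in> invariant_measures P \<theta> T"
    by (simp add: invariant_measures_def)
  moreover have "pr (\<lambda>_. 0) \<le> pr f - ereal (\<integral>z. f z \<partial>\<mu>)" if f: "f \<in> L1_C P" for f
    using L_le[OF f] int(2)[OF f] zero pr_q[OF f] by simp
  ultimately show ?thesis by blast
qed

text \<open>The potential 0 gives the upper bound for every measure, so only attainment takes work.
  The assumption \<open>inv\<close> supplies the measure when the pressure at 0 is
  -\<infinity>.\<close>

lemma is_max_over_pressure:
  assumes A: "admissible A"
    and pr: "\<And>f r. pr f \<le> ereal r \<longleftrightarrow> growth_le A K f r"
    and zero: "pr (\<lambda>_. 0) < \<infinity>"
    and inv: "invariant_measures P \<theta> T \<noteq> {}"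
  shows "is_max_over (pr (\<lambda>_. 0)) (\<lambda>\<mu>. INF f\<in>L1_C P. pr f - ereal (\<integral>z. f z \<partial>\<mu>)) (invariant_measures P \<theta> T)"
proof -
  have le: "(INF f\<in>L1_C P. pr f - ereal (\<integral>z. f z \<partial>\<mu>)) \<le> pr (\<lambda>_. 0)" for \<mu> :: "('w \<times> 'x) measure"
  proof -
    have "(INF f\<in>L1_C P. pr f - ereal (\<integral>z. f z \<partial>\<mu>)) \<le> pr (\<lambda>_. 0) - ereal (\<integral>z. 0 \<partial>\<mu>)"
      by (rule INF_lower[OF L1.V_const])
    then show ?thesis by simp
  qed
  have "\<exists>\<mu>\<in>invariant_measures P \<theta> T. pr (\<lambda>_. 0) \<le> (INF f\<in>L1_C P. pr f - ereal (\<integral>z. f z \<partial>\<mu>))"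
  proof (cases "pr (\<lambda>_. 0)")
    case (real p0)
    then show ?thesis
      using equilibrium_measure[OF A pr real] by (auto intro!: INF_greatest)
  next
    case MInf
    then show ?thesis using inv by auto
  qed (use zero in simp)
  then show ?thesis
    unfolding is_max_over_def using le antisym by blast
qed

section \<open>The three pressures as growth rates\<close>

lemma eps_expressions:
  "P_pre_eps P \<theta> T f \<epsilon> = limsup (\<lambda>n. ereal (1 / real n) * (SUP k\<in>{n..}. log_growth f n k \<epsilon> UNIV))"
  "P_pre_m_eps P \<theta> T f \<epsilon> = limsup (\<lambda>n. ereal (1 / real n) * log_growth f n n \<epsilon> UNIV)"
  "P_pre_p_eps P \<theta> T f \<epsilon> = (SUP x. limsup (\<lambda>n. ereal (1 / real n) * log_growth f n n \<epsilon> {x}))"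
  by (simp_all add: P_pre_eps_def P_pre_m_eps_def P_pre_p_eps_def log_growth_def partition_sup_def)

lemma log_growth_antimono:
  assumes "\<epsilon> \<le> \<epsilon>'"
  shows "log_growth f n k \<epsilon>' S \<le> log_growth f n k \<epsilon> S"
  unfolding log_growth_def partition_sup_def
  by (intro ereal_integral_mono log_ennreal_mono SUP_mono') (rule pre_partition_antimono[OF assms])

lemma pressure_SUP:
  "P_pre P \<theta> T f = (SUP \<epsilon>\<in>{0<..}. P_pre_eps P \<theta> T f \<epsilon>)"
  "P_pre_m P \<theta> T f = (SUP \<epsilon>\<in>{0<..}. P_pre_m_eps P \<theta> T f \<epsilon>)"
  "P_pre_p P \<theta> T f = (SUP \<epsilon>\<in>{0<..}. P_pre_p_eps P \<theta> T f \<epsilon>)"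
  unfolding P_pre_def P_pre_m_def P_pre_p_def
  by (rule Lim_at_right_antimono; unfold eps_expressions;
      intro SUP_mono' Limsup_mono always_eventually allI ereal_mult_left_mono log_growth_antimono; simp)+

lemma P_pre_le_iff: "P_pre P \<theta> T f \<le> ereal r \<longleftrightarrow> growth_le ({0<..} \<times> {UNIV}) (\<lambda>n. {n..}) f r"
  unfolding pressure_SUP eps_expressions SUP_le_iff limsup_average_le_iff growth_le_def by auto

lemma P_pre_m_le_iff: "P_pre_m P \<theta> T f \<le> ereal r \<longleftrightarrow> growth_le ({0<..} \<times> {UNIV}) (\<lambda>n. {n}) f r"
  unfolding pressure_SUP eps_expressions SUP_le_iff limsup_average_le_iff growth_le_def by auto

lemma P_pre_p_le_iff: "P_pre_p P \<theta> T f \<le> ereal r \<longleftrightarrow> growth_le ({0<..} \<times> range (\<lambda>x. {x})) (\<lambda>n. {n}) f r"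
  unfolding pressure_SUP eps_expressions SUP_le_iff limsup_average_le_iff growth_le_def by auto

lemma admissible_bases: "admissible ({0<..} \<times> {UNIV})" "admissible ({0<..} \<times> range (\<lambda>x. {x}))"
  by (auto simp: admissible_def)

text \<open>The base point may depend on \<omega>: the fibre over
  \<open>iter \<theta> T k \<omega> y\<close> contains \<open>y\<close>, and a singleton is
  separated. For a fixed base point the fibre can be empty, so the argument is confined to
  \<open>UNIV\<close>.\<close>

lemma log_growth_zero_nonneg: "0 \<le> log_growth (\<lambda>_. 0) n k \<epsilon> UNIV"
proof -
  have "1 \<le> partition_sup (\<lambda>_. 0) n k \<epsilon> UNIV \<omega>" for \<omega>
  proof -
    obtain y :: 'x where True by blast
    have "{y} \<in> {F. separated_set \<theta> T \<omega> n \<epsilon> (iter \<theta> T k \<omega> -` {iter \<theta> T k \<omega> y}) F}"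
      by (simp add: separated_set_def)
    then have "ennreal (\<Sum>y\<in>{y}. exp (birkhoff_sum \<theta> T (\<lambda>_. 0) n \<omega> y))
        \<le> pre_partition \<theta> T (\<lambda>_. 0) n \<omega> (iter \<theta> T k \<omega> y) \<epsilon> k"
      unfolding pre_partition_def by (rule SUP_upper)
    also have "\<dots> \<le> partition_sup (\<lambda>_. 0) n k \<epsilon> UNIV \<omega>"
      unfolding partition_sup_def by (rule SUP_upper) simp
    finally show ?thesis
      by (simp add: birkhoff_sum_def)
  qed
  then have "0 \<le> log_ennreal (partition_sup (\<lambda>_. 0) n k \<epsilon> UNIV \<omega>)" for \<omega>
  proof -
    have "log_ennreal 1 = 0"
      by (simp add: log_ennreal_def zero_ereal_def)
    then show ?thesis
      using log_ennreal_mono[OF \<open>1 \<le> partition_sup (\<lambda>_. 0) n k \<epsilon> UNIV \<omega>\<close>] by simp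
  qed
  then have "ereal_integral P (\<lambda>_. 0) \<le> log_growth (\<lambda>_. 0) n k \<epsilon> UNIV"
    unfolding log_growth_def by (rule ereal_integral_mono)
  then show ?thesis
    using ereal_integral_real[of P "\<lambda>_. 0"] by (simp flip: zero_ereal_def)
qed

lemma h_pre_m_le: "h_pre_m P \<theta> T \<le> h_pre P \<theta> T"
  unfolding h_pre_m_def h_pre_def pressure_SUP eps_expressions
  by (intro SUP_mono' Limsup_mono always_eventually allI ereal_mult_left_mono SUP_upper) auto

lemma h_pre_p_le: "h_pre_p P \<theta> T \<le> h_pre_m P \<theta> T"
proof -
  have "log_growth (\<lambda>_. 0) n k \<epsilon> {x} \<le> log_growth (\<lambda>_. 0) n k \<epsilon> UNIV" for n k \<epsilon> x
    unfolding log_growth_def partition_sup_def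
    by (intro ereal_integral_mono log_ennreal_mono SUP_subset_mono) auto
  then show ?thesis
    unfolding h_pre_m_def h_pre_p_def pressure_SUP eps_expressions
    by (intro SUP_mono' SUP_least Limsup_mono always_eventually allI ereal_mult_left_mono) auto
qed

lemma h_pre_m_nonneg: "0 \<le> h_pre_m P \<theta> T"
proof -
  have "0 \<le> limsup (\<lambda>n. ereal (1 / real n) * log_growth (\<lambda>_. 0) n n 1 UNIV)"
    by (intro le_Limsup always_eventually allI) (auto simp: log_growth_zero_nonneg)
  then show ?thesis
    unfolding h_pre_m_def pressure_SUP eps_expressions by (rule SUP_upper2[rotated]) simp
qed

theorem variational_principle:
  assumes fin: "h_pre P \<theta> T < \<infinity>"
  shows "is_max_over (h_pre P \<theta> T) (h_pre_measure P \<theta> T) (invariant_measures P \<theta> T)"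
    and "is_max_over (h_pre_p P \<theta> T) (h_p_measure P \<theta> T) (invariant_measures P \<theta> T)"
    and "is_max_over (h_pre_m P \<theta> T) (h_m_measure P \<theta> T) (invariant_measures P \<theta> T)"
proof -
  have m: "P_pre_m P \<theta> T (\<lambda>_. 0) < \<infinity>"
    using h_pre_m_le fin unfolding h_pre_m_def by (rule le_less_trans)
  have p: "P_pre_p P \<theta> T (\<lambda>_. 0) < \<infinity>"
    using h_pre_p_le m unfolding h_pre_p_def h_pre_m_def by (rule le_less_trans)
  \<comment> \<open>\<open>P_pre_m\<close> at 0 lies between 0 and the finite \<open>h_pre\<close>,
    hence is real and has an equilibrium measure; this shows that invariant measures exist.\<close>
  obtain p0 where "P_pre_m P \<theta> T (\<lambda>_. 0) = ereal p0"
    using m h_pre_m_nonneg unfolding h_pre_m_def by (cases "P_pre_m P \<theta> T (\<lambda>_. 0)") auto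
  from equilibrium_measure[OF admissible_bases(1) P_pre_m_le_iff this]
  have inv: "invariant_measures P \<theta> T \<noteq> {}" by blast
  show "is_max_over (h_pre P \<theta> T) (h_pre_measure P \<theta> T) (invariant_measures P \<theta> T)"
    unfolding h_pre_measure_def[abs_def] h_pre_def
    using fin inv by (intro is_max_over_pressure[OF admissible_bases(1) P_pre_le_iff]) (simp_all add: h_pre_def)
  show "is_max_over (h_pre_p P \<theta> T) (h_p_measure P \<theta> T) (invariant_measures P \<theta> T)"
    unfolding h_p_measure_def[abs_def] h_pre_p_def
    by (rule is_max_over_pressure[OF admissible_bases(2) P_pre_p_le_iff p inv])
  show "is_max_over (h_pre_m P \<theta> T) (h_m_measure P \<theta> T) (invariant_measures P \<theta> T)"
    unfolding h_m_measure_def[abs_def] h_pre_m_def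
    by (rule is_max_over_pressure[OF admissible_bases(1) P_pre_m_le_iff m inv])
qed

end

theorem theoremC:
  fixes P :: "'w::metric_space measure"
    and \<theta> :: "'w \<Rightarrow> 'w"
    and T :: "'w \<Rightarrow> 'x::metric_space \<Rightarrow> 'x"
  assumes "locally_compact_space (euclidean :: 'w topology)"
    and "separable_space (euclidean :: 'w topology)"
    and "sets P = sets borel"
    and "ergodic_system P \<theta>"
    and "compact (UNIV :: 'x set)"
    and "random_maps P T"
    and "h_pre P \<theta> T < \<infinity>"
  shows "is_max_over (h_pre P \<theta> T) (h_pre_measure P \<theta> T) (invariant_measures P \<theta> T) \<and>
    is_max_over (h_pre_p P \<theta> T) (h_p_measure P \<theta> T) (invariant_measures P \<theta> T) \<and>
    is_max_over (h_pre_m P \<theta> T) (h_m_measure P \<theta> T) (invariant_measures P \<theta> T)"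
proof -
  have "random_system P \<theta> T"
  proof
    show "space P = UNIV"
      using sets_eq_imp_space_eq[OF assms(3)] by simp
    show "measure_preserving_system P \<theta>"
      using assms(4) by (simp add: ergodic_system_def)
  qed fact+
  then interpret random_system P \<theta> T .
  show ?thesis
    using variational_principle[OF assms(7)] by blast
qed

end
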